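(* For $n>5$ and $0\le k\le n-5$, the Tanaka symbol $\mathfrak s^{k,n}$ does not admit a linear invariant normalization condition.
   Context: The Lie algebra $\mathfrak{gl}_2(\mathbb R)\rtimes\mathfrak{heis}_{2n-5}$: $\mathfrak{gl}_2(\mathbb R)$ has basis $Y,H,E,X$ with nontrivial brackets $[X,Y]=H$, $[H,X]=2X$, $[H,Y]=-2Y$ ($E$ central). $\mathfrak{heis}_{2n-5}$ has basis $\varepsilon_1,\dots,\varepsilon_{2n-6},\eta$ with nontrivial brackets $[\varepsilon_i,\varepsilon_{2n-5-i}]=(-1)^i\eta$, $1\le i\le 2n-6$. The action is: $[H,\varepsilon_i]=(2i+5-2n)\varepsilon_i$, $[H,\eta]=0$; $[E,\varepsilon_i]=\varepsilon_i$, $[E,\eta]=2\eta$; $[X,\varepsilon_i]=\varepsilon_{i+1}$ for $1\le i\le 2n-7$, $[X,\varepsilon_{2n-6}]=0$, $[X,\eta]=0$; $[Y,\varepsilon_1]=0$, $[Y,\varepsilon_i]=(i-1)(2n-5-i)\varepsilon_{i-1}$ for $2\le i\le 2n-6$, $[Y,\eta]=0$. $\mathfrak s^{k,n}$ is the negative part of this Lie algebra with grading $\mathrm{wght}(Y)=1$, $\mathrm{wght}(H)=\mathrm{wght}(E)=0$, $\mathrm{wght}(X)=-1$, $\mathrm{wght}(\varepsilon_i)=n-4-k-i$, $\mathrm{wght}(\eta)=-3-2k$ (i.e. $\mathfrak s^{k,n}$ is spanned by $X$, $\eta$ and $\varepsilon_i$ with $i\ge n-3-k$). Universal Tanaka prolongation: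 for a negatively graded nilpotent Lie algebra $\mathfrak m$ generated by $\mathfrak m_{-1}$, $\mathfrak g(\mathfrak m)=\bigoplus_i\mathfrak g_i$ is the largest graded Lie algebra with $\mathfrak g_i=\mathfrak m_i$ for $i<0$ and such that if $X\in\mathfrak g_i$, $i\ge0$, satisfies $[X,Y]=0$ for all $Y\in\mathfrak g_{-1}$, then $X=0$. Write $\mathfrak g=\mathfrak g(\mathfrak m)$, $\mathfrak g^0=\bigoplus_{i\ge0}\mathfrak g_i$. Linear invariant normalization condition: let $C^k(\mathfrak m,\mathfrak g)=\bigwedge^k\mathfrak m^*\otimes\mathfrak g\cong\bigwedge^k(\mathfrak g/\mathfrak g^0)^*\otimes\mathfrak g$, with the $\mathfrak g^0$-action induced by the adjoint action. The subspace $\mathfrak g_{i_1}^*\wedge\dots\wedge\mathfrak g_{i_k}^*\otimes\mathfrak g_{j}$ (all $i_r<0$) has weight $j-\sum_r i_r$, and $C^k_+(\mathfrak m,\mathfrak g)$ is the span of the cochains of positive weight. The coboundary $\partial:C^1(\mathfrak m,\mathfrak g)\to C^2(\mathfrak m,\mathfrak g)$ is $\partial\phi(X,Y)=[X,\phi(Y)]-[Y,\phi(X)]-\phi([X,Y])$; it preserves weight. A linear invariant normalization condition for $\mathfrak m$ is a $\mathfrak g^0$-invariant subspace $\mathcal N\subseteq C^2_+(\mathfrak m,\mathfrak g)$ which is the direct sum of its weight components and satisfies $C^2_+(\mathfrak m,\mathfrak g)=\mathcal N\oplus\partial\big(C^1_+(\mathfrak m,\mathfrak g)\big)$, where $\mathfrak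 g=\mathfrak g(\mathfrak m)$. *)

theory Defs
  imports "HOL-Analysis.Finite_Function_Topology"
begin

section \<open>Graded Lie algebras\<close>

text \<open>Lie algebras are subspaces of an ambient real vector space together with a bracket.
  The bracket is a total function, but only its values on the subspace matter. A grading is a family
  \<^term>\<open>G :: int \<Rightarrow> 'a set\<close> of subspaces, and \<open>graded_sum G I\<close> is the sum of the \<open>G i\<close>
  with \<open>i \<in> I\<close>.\<close>

definition linear_on :: "'a::real_vector set \<Rightarrow> ('a \<Rightarrow> 'b::real_vector) \<Rightarrow> bool" where
  "linear_on S f \<longleftrightarrow>
     (\<forall>x\<in>S. \<forall>y\<in>S. f (x + y) = f x + f y) \<and> (\<forall>c. \<forall>x\<in>S. f (c *\<^sub>R x) = c *\<^sub>R f x)"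

definition graded_sum :: "(int \<Rightarrow> 'a::real_vector set) \<Rightarrow> int set \<Rightarrow> 'a set" where
  "graded_sum G I = span (\<Union>i\<in>I. G i)"

abbreviation total_space :: "(int \<Rightarrow> 'a::real_vector set) \<Rightarrow> 'a set" where
  "total_space G \<equiv> graded_sum G UNIV"

abbreviation neg_space :: "(int \<Rightarrow> 'a::real_vector set) \<Rightarrow> 'a set" where
  "neg_space G \<equiv> graded_sum G {..<0}"

abbreviation nonneg_space :: "(int \<Rightarrow> 'a::real_vector set) \<Rightarrow> 'a set" where
  "nonneg_space G \<equiv> graded_sum G {0..}"

locale graded_lie_algebra =
  fixes G :: "int \<Rightarrow> 'a::real_vector set" and br :: "'a \<Rightarrow> 'a \<Rightarrow> 'a"
  assumes subspace_component: "subspace (G i)"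
    and direct: "finite I \<Longrightarrow> (\<And>i. i \<in> I \<Longrightarrow> u i \<in> G i) \<Longrightarrow> (\<Sum>i\<in>I. u i) = 0 \<Longrightarrow> j \<in> I \<Longrightarrow> u j = 0"
    and linear_left: "y \<in> total_space G \<Longrightarrow> linear_on (total_space G) (\<lambda>x. br x y)"
    and linear_right: "x \<in> total_space G \<Longrightarrow> linear_on (total_space G) (br x)"
    and bracket_self: "x \<in> total_space G \<Longrightarrow> br x x = 0"
    and jacobi: "x \<in> total_space G \<Longrightarrow> y \<in> total_space G \<Longrightarrow> z \<in> total_space G \<Longrightarrow>
                   br x (br y z) + br y (br z x) + br z (br x y) = 0"
    and bracket_degree: "x \<in> G i \<Longrightarrow> y \<in> G j \<Longrightarrow> br x y \<in> G (i + j)"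

section \<open>The universal Tanaka prolongation\<close>

definition tanaka_extension ::
  "(int \<Rightarrow> 'a::real_vector set) \<Rightarrow> ('a \<Rightarrow> 'a \<Rightarrow> 'a) \<Rightarrow> (int \<Rightarrow> 'a set) \<Rightarrow> ('a \<Rightarrow> 'a \<Rightarrow> 'a) \<Rightarrow> bool" where
  "tanaka_extension M brM G br \<longleftrightarrow>
     graded_lie_algebra G br \<and>
     (\<forall>i<0. G i = M i) \<and>
     (\<forall>x\<in>neg_space M. \<forall>y\<in>neg_space M. br x y = brM x y) \<and>
     (\<forall>i\<ge>0. \<forall>x\<in>G i. (\<forall>y\<in>G (-1). br x y = 0) \<longrightarrow> x = 0)"

text \<open>The largest such algebra: every other one embeds into it, as a graded Lie algebra, by a map
  which is the identity on the negative part. All the algebras compared live in the same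
  ambient space \<^typ>\<open>'a\<close>. This loses nothing if the negative part is finite dimensional and has infinite
  codimension in \<^typ>\<open>'a\<close>, since then the components of every extension are finite dimensional
  (the bracket embeds the component of degree \<open>i \<ge> 0\<close> into the linear maps from degree \<open>-1\<close> to
  degree \<open>i - 1\<close>), so that every extension has countable dimension.\<close>

definition universal_tanaka_prolongation ::
  "(int \<Rightarrow> 'a::real_vector set) \<Rightarrow> ('a \<Rightarrow> 'a \<Rightarrow> 'a) \<Rightarrow> (int \<Rightarrow> 'a set) \<Rightarrow> ('a \<Rightarrow> 'a \<Rightarrow> 'a) \<Rightarrow> bool" where
  "universal_tanaka_prolongation M brM G br \<longleftrightarrow>
     tanaka_extension M brM G br \<and>
     (\<forall>G' br'. tanaka_extension M brM G' br' \<longrightarrow>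
        (\<exists>f. linear_on (total_space G') f \<and> inj_on f (total_space G') \<and>
             (\<forall>i. f ` G' i \<subseteq> G i) \<and>
             (\<forall>x\<in>total_space G'. \<forall>y\<in>total_space G'. f (br' x y) = br (f x) (f y)) \<and>
             (\<forall>x\<in>neg_space M. f x = x)))"

section \<open>Cochains and linear invariant normalization conditions\<close>

text \<open>With \<open>\<mm>\<close> the negative part of \<open>\<gg>\<close>, cochains are alternating multilinear maps on \<open>\<mm>\<close> with
  values in \<open>\<gg>\<close>, made into total functions by the value 0 outside of \<open>\<mm>\<close>, so that equality of functions
  is equality of cochains.\<close>

definition cochains1 :: "(int \<Rightarrow> 'a::real_vector set) \<Rightarrow> ('a \<Rightarrow> 'a) set" where
  "cochains1 G = {\<phi>. linear_on (neg_space G) \<phi> \<and>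
     (\<forall>x\<in>neg_space G. \<phi> x \<in> total_space G) \<and> (\<forall>x. x \<notin> neg_space G \<longrightarrow> \<phi> x = 0)}"

definition cochains2 :: "(int \<Rightarrow> 'a::real_vector set) \<Rightarrow> ('a \<Rightarrow> 'a \<Rightarrow> 'a) set" where
  "cochains2 G = {\<phi>.
     (\<forall>y\<in>neg_space G. linear_on (neg_space G) (\<lambda>x. \<phi> x y)) \<and>
     (\<forall>x\<in>neg_space G. linear_on (neg_space G) (\<phi> x)) \<and>
     (\<forall>x\<in>neg_space G. \<phi> x x = 0) \<and>
     (\<forall>x\<in>neg_space G. \<forall>y\<in>neg_space G. \<phi> x y \<in> total_space G) \<and>
     (\<forall>x y. x \<notin> neg_space G \<or> y \<notin> neg_space G \<longrightarrow> \<phi> x y = 0)}"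

definition cochains1_weight :: "(int \<Rightarrow> 'a::real_vector set) \<Rightarrow> int \<Rightarrow> ('a \<Rightarrow> 'a) set" where
  "cochains1_weight G w = {\<phi> \<in> cochains1 G. \<forall>i<0. \<forall>x\<in>G i. \<phi> x \<in> G (i + w)}"

definition cochains2_weight :: "(int \<Rightarrow> 'a::real_vector set) \<Rightarrow> int \<Rightarrow> ('a \<Rightarrow> 'a \<Rightarrow> 'a) set" where
  "cochains2_weight G w =
     {\<phi> \<in> cochains2 G. \<forall>i<0. \<forall>j<0. \<forall>x\<in>G i. \<forall>y\<in>G j. \<phi> x y \<in> G (i + j + w)}"

definition cochains1_pos :: "(int \<Rightarrow> 'a::real_vector set) \<Rightarrow> ('a \<Rightarrow> 'a) set" where
  "cochains1_pos G = {\<lambda>x. \<Sum>w\<in>W. \<phi> w x | W \<phi>.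
     finite W \<and> W \<subseteq> {0<..} \<and> (\<forall>w\<in>W. \<phi> w \<in> cochains1_weight G w)}"

definition cochains2_pos :: "(int \<Rightarrow> 'a::real_vector set) \<Rightarrow> ('a \<Rightarrow> 'a \<Rightarrow> 'a) set" where
  "cochains2_pos G = {\<lambda>x y. \<Sum>w\<in>W. \<phi> w x y | W \<phi>.
     finite W \<and> W \<subseteq> {0<..} \<and> (\<forall>w\<in>W. \<phi> w \<in> cochains2_weight G w)}"

definition coboundary ::
  "(int \<Rightarrow> 'a::real_vector set) \<Rightarrow> ('a \<Rightarrow> 'a \<Rightarrow> 'a) \<Rightarrow> ('a \<Rightarrow> 'a) \<Rightarrow> 'a \<Rightarrow> 'a \<Rightarrow> 'a" where
  "coboundary G br \<phi> = (\<lambda>x y.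
     if x \<in> neg_space G \<and> y \<in> neg_space G then br x (\<phi> y) - br y (\<phi> x) - \<phi> (br x y) else 0)"

text \<open>The projection of \<open>\<gg>\<close> onto \<open>\<mm>\<close> along \<open>\<gg>\<^sup>0\<close> realizes the identification of
  \<open>\<gg>/\<gg>\<^sup>0\<close> with \<open>\<mm>\<close>.\<close>

definition neg_part :: "(int \<Rightarrow> 'a::real_vector set) \<Rightarrow> 'a \<Rightarrow> 'a" where
  "neg_part G x = (THE u. u \<in> neg_space G \<and> x - u \<in> nonneg_space G)"

text \<open>The action of \<open>a \<in> \<gg>\<^sup>0\<close> on 2-cochains: the adjoint action on values, and minus
  the action induced on \<open>\<gg>/\<gg>\<^sup>0\<close> (identified with \<open>\<mm>\<close>) on arguments.\<close>

definition cochain_action ::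
  "(int \<Rightarrow> 'a::real_vector set) \<Rightarrow> ('a \<Rightarrow> 'a \<Rightarrow> 'a) \<Rightarrow> 'a \<Rightarrow> ('a \<Rightarrow> 'a \<Rightarrow> 'a) \<Rightarrow> 'a \<Rightarrow> 'a \<Rightarrow> 'a" where
  "cochain_action G br a \<phi> = (\<lambda>x y.
     if x \<in> neg_space G \<and> y \<in> neg_space G
     then br a (\<phi> x y) - \<phi> (neg_part G (br a x)) y - \<phi> x (neg_part G (br a y)) else 0)"

definition linear_invariant_normalization ::
  "(int \<Rightarrow> 'a::real_vector set) \<Rightarrow> ('a \<Rightarrow> 'a \<Rightarrow> 'a) \<Rightarrow> ('a \<Rightarrow> 'a \<Rightarrow> 'a) set \<Rightarrow> bool" where
  "linear_invariant_normalization G br N \<longleftrightarrow>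
     N \<subseteq> cochains2_pos G \<and>
     (\<lambda>x y. 0) \<in> N \<and>
     (\<forall>\<phi>\<in>N. \<forall>\<psi>\<in>N. (\<lambda>x y. \<phi> x y + \<psi> x y) \<in> N) \<and>
     (\<forall>c. \<forall>\<phi>\<in>N. (\<lambda>x y. c *\<^sub>R \<phi> x y) \<in> N) \<and>
     (\<forall>a\<in>nonneg_space G. \<forall>\<phi>\<in>N. cochain_action G br a \<phi> \<in> N) \<and>
     (\<forall>\<phi>\<in>N. \<exists>W \<psi>. finite W \<and> (\<forall>w\<in>W. \<psi> w \<in> N \<inter> cochains2_weight G w) \<and>
              \<phi> = (\<lambda>x y. \<Sum>w\<in>W. \<psi> w x y)) \<and>
     cochains2_pos G =
       {\<lambda>x y. \<phi> x y + coboundary G br \<psi> x y | \<phi> \<psi>. \<phi> \<in> N \<and> \<psi> \<in> cochains1_pos G} \<and>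
     N \<inter> coboundary G br ` cochains1_pos G = {\<lambda>x y. 0}"

definition admits_linear_invariant_normalization ::
  "(int \<Rightarrow> 'a::real_vector set) \<Rightarrow> ('a \<Rightarrow> 'a \<Rightarrow> 'a) \<Rightarrow> bool" where
  "admits_linear_invariant_normalization M brM \<longleftrightarrow>
     (\<exists>G br N. universal_tanaka_prolongation M brM G br \<and> linear_invariant_normalization G br N)"

section \<open>The Lie algebra \<open>\<gg>\<ll>\<^sub>2(\<real>) \<rtimes> \<hh>\<ee>\<ii>\<ss>\<^bsub>2n-5\<^esub>\<close> and its negative part\<close>

text \<open>The ambient space is spanned by \<open>Y, H, E, X, \<eta>\<close> and all \<open>\<epsilon>\<^sub>i\<close>, \<open>i \<in> \<nat>\<close>. The Lie algebra
  is the subspace in which only the \<open>\<epsilon>\<^sub>i\<close> with \<open>1 \<le> i \<le> 2n-6\<close> occur; the remaining \<open>\<epsilon>\<^sub>i\<close>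
  make its codimension infinite, as \<open>universal_tanaka_prolongation\<close> needs.\<close>

datatype gen = genY | genH | genE | genX | genEta | genEps nat

type_synonym ambient = "gen \<Rightarrow>\<^sub>0 real"

abbreviation basis_vec :: "gen \<Rightarrow> ambient" where
  "basis_vec b \<equiv> Poly_Mapping.single b 1"

definition gl2_heis_gens :: "nat \<Rightarrow> gen set" where
  "gl2_heis_gens n = {genY, genH, genE, genX, genEta} \<union> genEps ` {1..2 * n - 6}"

fun gen_bracket :: "nat \<Rightarrow> gen \<Rightarrow> gen \<Rightarrow> ambient" where
  "gen_bracket n genX genY = basis_vec genH"
| "gen_bracket n genY genX = - basis_vec genH"
| "gen_bracket n genH genX = 2 *\<^sub>R basis_vec genX"
| "gen_bracket n genX genH = - (2 *\<^sub>R basis_vec genX)"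
| "gen_bracket n genH genY = - (2 *\<^sub>R basis_vec genY)"
| "gen_bracket n genY genH = 2 *\<^sub>R basis_vec genY"
| "gen_bracket n (genEps i) (genEps j) =
     (if i + j + 5 = 2 * n then (- 1) ^ i *\<^sub>R basis_vec genEta else 0)"
| "gen_bracket n genH (genEps i) = (2 * real i + 5 - 2 * real n) *\<^sub>R basis_vec (genEps i)"
| "gen_bracket n (genEps i) genH = - ((2 * real i + 5 - 2 * real n) *\<^sub>R basis_vec (genEps i))"
| "gen_bracket n genE (genEps i) = basis_vec (genEps i)"
| "gen_bracket n (genEps i) genE = - basis_vec (genEps i)"
| "gen_bracket n genE genEta = 2 *\<^sub>R basis_vec genEta"
| "gen_bracket n genEta genE = - (2 *\<^sub>R basis_vec genEta)"
| "gen_bracket n genX (genEps i) = (if i + 7 \<le> 2 * n then basis_vec (genEps (i + 1)) else 0)"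
| "gen_bracket n (genEps i) genX = - (if i + 7 \<le> 2 * n then basis_vec (genEps (i + 1)) else 0)"
| "gen_bracket n genY (genEps i) =
     (if 2 \<le> i then ((real i - 1) * (2 * real n - 5 - real i)) *\<^sub>R basis_vec (genEps (i - 1)) else 0)"
| "gen_bracket n (genEps i) genY =
     - (if 2 \<le> i then ((real i - 1) * (2 * real n - 5 - real i)) *\<^sub>R basis_vec (genEps (i - 1)) else 0)"
| "gen_bracket n _ _ = 0"

definition gl2_heis_bracket :: "nat \<Rightarrow> ambient \<Rightarrow> ambient \<Rightarrow> ambient" where
  "gl2_heis_bracket n u v =
     (\<Sum>a\<in>Poly_Mapping.keys u. \<Sum>b\<in>Poly_Mapping.keys v.
        (Poly_Mapping.lookup u a * Poly_Mapping.lookup v b) *\<^sub>R gen_bracket n a b)"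

fun wght :: "nat \<Rightarrow> nat \<Rightarrow> gen \<Rightarrow> int" where
  "wght k n genY = 1"
| "wght k n genH = 0"
| "wght k n genE = 0"
| "wght k n genX = -1"
| "wght k n (genEps i) = int n - 4 - int k - int i"
| "wght k n genEta = - 3 - 2 * int k"

definition gl2_heis_grading :: "nat \<Rightarrow> nat \<Rightarrow> int \<Rightarrow> ambient set" where
  "gl2_heis_grading k n i = span (basis_vec ` {b \<in> gl2_heis_gens n. wght k n b = i})"

text \<open>\<open>\<ss>\<^bsup>k,n\<^esup>\<close> is given by this grading together with the bracket \<^term>\<open>gl2_heis_bracket n\<close>.\<close>

definition symbol_grading :: "nat \<Rightarrow> nat \<Rightarrow> int \<Rightarrow> ambient set" where
  "symbol_grading k n i = (if i < 0 then gl2_heis_grading k n i else {0})"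

end

theory Submission
  imports Defs
begin

text \<open>Write \<open>e\<^sub>i = \<epsilon>\<^bsub>n-4-k+i\<^esub>\<close>, which has weight \<open>-i\<close>, and \<open>p = 2k+3\<close>, so that \<open>[e\<^sub>i, e\<^sub>j]\<close> is a nonzero
  multiple of \<open>\<eta>\<close> iff \<open>i + j = p\<close>. The obstruction comes from the nilpotent element \<open>e\<^sub>0\<close> of degree 0
  alone. Since \<open>\<partial>\<close> is \<open>\<gg>\<^sub>0\<close>-equivariant, an invariant complement of the coboundaries splits them off
  as a module over \<open>e\<^sub>0\<close>: if \<open>e\<^sub>0 \<cdot> \<phi> = \<partial>\<psi>\<^sub>0\<close>, then \<open>\<partial>(e\<^sub>0 \<cdot> \<psi>) = \<partial>\<psi>\<^sub>0\<close> for some \<open>\<psi>\<close> of the same weight. In weight 1,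
  \<open>\<psi>\<^sub>0 = e\<^sub>1\<^sup>* \<otimes> e\<^sub>0\<close> has a coboundary of the form \<open>e\<^sub>0 \<cdot> \<phi>\<close>, but \<open>e\<^sub>0 \<cdot> \<psi> - \<psi>\<^sub>0\<close> is never a derivation
  \<open>\<mm> \<rightarrow> \<gg>\<close>: a derivation is determined by its values on \<open>X\<close> and \<open>e\<^sub>1\<close>, and computing it on
  \<open>e\<^sub>2, \<dots>, e\<^sub>5\<close> and \<open>\<eta>\<close> gives contradictory linear equations.

  All values of \<open>\<psi>\<close> that matter have degree at most 0, so the prolongation need not be determined:
  it suffices that it contains \<open>e\<^sub>0\<close>, which follows from universality applied to \<open>\<mm> \<oplus> \<langle>e\<^sub>0\<rangle>\<close>.\<close>

section \<open>Graded Lie algebras and the action of degree 0\<close>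

context graded_lie_algebra
begin

section \<open>Calculus of the bracket on graded sums\<close>

lemma component_total: "x \<in> G i \<Longrightarrow> x \<in> total_space G"
  by (auto simp: graded_sum_def intro: span_base)

lemma component_neg: "x \<in> G i \<Longrightarrow> i < 0 \<Longrightarrow> x \<in> neg_space G"
  by (auto simp: graded_sum_def intro: span_base)

lemma neg_total: "x \<in> neg_space G \<Longrightarrow> x \<in> total_space G"
  unfolding graded_sum_def by (rule subsetD[OF span_mono]) auto

lemma subspace_graded_sum: "subspace (graded_sum G I)"
  by (simp add: graded_sum_def)

lemmas graded_sum_closed [simp] =
  subspace_0[OF subspace_graded_sum] subspace_add[OF subspace_graded_sum]
  subspace_diff[OF subspace_graded_sum] subspace_scale[OF subspace_graded_sum]
  subspace_neg[OF subspace_graded_sum] subspace_sum[OF subspace_graded_sum]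

lemmas component_closed =
  subspace_0[OF subspace_component] subspace_add[OF subspace_component]
  subspace_diff[OF subspace_component] subspace_scale[OF subspace_component]
  subspace_neg[OF subspace_component] subspace_sum[OF subspace_component]

lemma graded_sum_induct:
  assumes "x \<in> graded_sum G I" "subspace T" "\<And>i. i \<in> I \<Longrightarrow> G i \<subseteq> T"
  shows "x \<in> T"
  using assms span_minimal[of "\<Union>i\<in>I. G i" T] unfolding graded_sum_def by blast

lemma br_add_left:
  "x \<in> total_space G \<Longrightarrow> x' \<in> total_space G \<Longrightarrow> y \<in> total_space G \<Longrightarrow> br (x + x') y = br x y + br x' y"
  using linear_left by (simp add: linear_on_def)

lemma br_add_right:
  "x \<in> total_space G \<Longrightarrow> y \<in> total_space G \<Longrightarrow> y' \<in> total_space G \<Longrightarrow> br x (y + y') = br x y + br x y'"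
  using linear_right by (simp add: linear_on_def)

lemma br_scale_left:
  "x \<in> total_space G \<Longrightarrow> y \<in> total_space G \<Longrightarrow> br (c *\<^sub>R x) y = c *\<^sub>R br x y"
  using linear_left by (simp add: linear_on_def)

lemma br_scale_right:
  "x \<in> total_space G \<Longrightarrow> y \<in> total_space G \<Longrightarrow> br x (c *\<^sub>R y) = c *\<^sub>R br x y"
  using linear_right by (simp add: linear_on_def)

lemma br_zero_left [simp]: "y \<in> total_space G \<Longrightarrow> br 0 y = 0"
  using br_scale_left[of 0 y 0] by simp

lemma br_zero_right [simp]: "y \<in> total_space G \<Longrightarrow> br y 0 = 0"
  using br_scale_right[of y 0 0] by simp

lemma br_minus_left:
  "x \<in> total_space G \<Longrightarrow> y \<in> total_space G \<Longrightarrow> br (- x) y = - br x y"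
  using br_scale_left[of x y "-1"] by simp

lemma br_minus_right:
  "x \<in> total_space G \<Longrightarrow> y \<in> total_space G \<Longrightarrow> br x (- y) = - br x y"
  using br_scale_right[of x y "-1"] by simp

lemma br_diff_left:
  "x \<in> total_space G \<Longrightarrow> x' \<in> total_space G \<Longrightarrow> y \<in> total_space G \<Longrightarrow> br (x - x') y = br x y - br x' y"
  using br_add_left[of x "- x'" y] by (simp add: br_minus_left)

lemma br_diff_right:
  "x \<in> total_space G \<Longrightarrow> y \<in> total_space G \<Longrightarrow> y' \<in> total_space G \<Longrightarrow> br x (y - y') = br x y - br x y'"
  using br_add_right[of x y "- y'"] by (simp add: br_minus_right)

lemma br_sum_right:
  assumes "x \<in> total_space G" "\<And>i. i \<in> I \<Longrightarrow> y i \<in> total_space G"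
  shows "br x (\<Sum>i\<in>I. y i) = (\<Sum>i\<in>I. br x (y i))"
  using assms(2)
  by (induction I rule: infinite_finite_induct) (simp_all add: assms(1) br_add_right)

lemmas br_linear = br_add_left br_add_right br_scale_left br_scale_right
  br_minus_left br_minus_right br_diff_left br_diff_right

text \<open>Checked on homogeneous arguments, then extended linearly one argument at a time. The
  subspaces used also record membership in the total space, because the bracket is linear only
  there.\<close>

lemma br_graded_sum:
  assumes "x \<in> graded_sum G I" "y \<in> graded_sum G J" "\<And>i j. i \<in> I \<Longrightarrow> j \<in> J \<Longrightarrow> i + j \<in> K"
  shows "br x y \<in> graded_sum G K"
proof -
  have tot: "z \<in> graded_sum G L \<Longrightarrow> z \<in> total_space G" for z L
    unfolding graded_sum_def by (rule subsetD[OF span_mono]) auto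
  have base: "br x y \<in> graded_sum G K" if "x \<in> G i" "i \<in> I" "y \<in> G j" "j \<in> J" for x y i j
    using bracket_degree[OF that(1,3)] assms(3)[OF that(2,4)]
    by (auto simp: graded_sum_def intro: span_base)
  have one: "br x y \<in> graded_sum G K" if "x \<in> G i" "i \<in> I" for x i
  proof -
    have "y \<in> {y \<in> total_space G. br x y \<in> graded_sum G K}"
      using assms(2)
    proof (rule graded_sum_induct)
      show "subspace {y \<in> total_space G. br x y \<in> graded_sum G K}"
        unfolding subspace_def using component_total[OF that(1)]
        by (auto simp: br_linear)
    qed (use that base component_total in blast)
    then show ?thesis by simp
  qed
  have "x \<in> {x \<in> total_space G. br x y \<in> graded_sum G K}"
    using assms(1)
  proof (rule graded_sum_induct)
    show "subspace {x \<in> total_space G. br x y \<in> graded_sum G K}"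
      unfolding subspace_def using tot[OF assms(2)]
      by (auto simp: br_linear)
  qed (use one component_total in blast)
  then show ?thesis by simp
qed

lemma br_total [simp]: "x \<in> total_space G \<Longrightarrow> y \<in> total_space G \<Longrightarrow> br x y \<in> total_space G"
  by (rule br_graded_sum) auto

lemma br_neg: "x \<in> neg_space G \<Longrightarrow> y \<in> neg_space G \<Longrightarrow> br x y \<in> neg_space G"
  by (rule br_graded_sum) auto

lemma br_deg0_neg:
  assumes "A \<in> G 0" "x \<in> neg_space G"
  shows "br A x \<in> neg_space G"
proof -
  have "A \<in> graded_sum G {0}"
    using assms(1) by (auto simp: graded_sum_def intro: span_base)
  then show ?thesis
    by (rule br_graded_sum[OF _ assms(2)]) auto
qed

lemma br_antisym:
  assumes "x \<in> total_space G" "y \<in> total_space G"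
  shows "br x y = - br y x"
  using bracket_self[of "x + y"] bracket_self[of x] bracket_self[of y] assms
  by (simp add: br_linear eq_neg_iff_add_eq_0 add.commute)

lemma jacobi_derivation:
  assumes "x \<in> total_space G" "y \<in> total_space G" "z \<in> total_space G"
  shows "br x (br y z) = br (br x y) z + br y (br x z)"
proof -
  have "br y (br z x) = - br y (br x z)"
    using br_antisym[of z x] assms by (simp add: br_linear)
  moreover have "br z (br x y) = - br (br x y) z"
    using br_antisym[of z "br x y"] assms by simp
  ultimately show ?thesis
    using jacobi[OF assms] by (simp add: algebra_simps)
qed

lemma jacobi_derivation_left:
  assumes "x \<in> total_space G" "y \<in> total_space G" "z \<in> total_space G"
  shows "br (br x y) z = br x (br y z) - br y (br x z)"
  using jacobi_derivation[OF assms] by simp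

section \<open>Homogeneous components\<close>

text \<open>The family \<open>u\<close> is homogeneous at every index and zero off \<open>F\<close>,
  so that decompositions with different index sets can be added or compared over the union of these
  sets.\<close>

lemma graded_sum_decompose:
  assumes "x \<in> graded_sum G I"
  obtains F u where "finite F" "F \<subseteq> I" "\<And>i. u i \<in> G i" "\<And>i. i \<notin> F \<Longrightarrow> u i = 0" "x = (\<Sum>i\<in>F. u i)"
proof -
  let ?T = "{x. \<exists>F u. finite F \<and> F \<subseteq> I \<and> (\<forall>i. u i \<in> G i) \<and> (\<forall>i. i \<notin> F \<longrightarrow> u i = 0) \<and> x = (\<Sum>i\<in>F. u i)}"
  have "x \<in> ?T"
    using assms
  proof (rule graded_sum_induct)
    show "subspace ?T"
      unfolding subspace_def
    proof safe
      show "\<exists>F u. finite F \<and> F \<subseteq> I \<and> (\<forall>i. u i \<in> G i) \<and> (\<forall>i. i \<notin> F \<longrightarrow> u i = 0) \<and> 0 = (\<Sum>i\<in>F. u i)"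
        by (rule exI[of _ "{}"], rule exI[of _ "\<lambda>_. 0"]) (simp add: component_closed)
    next
      fix F u F' u'
      assume A: "finite F" "F \<subseteq> I" "\<forall>i. u i \<in> G i" "\<forall>i. i \<notin> F \<longrightarrow> u i = 0"
        "finite F'" "F' \<subseteq> I" "\<forall>i. u' i \<in> G i" "\<forall>i. i \<notin> F' \<longrightarrow> u' i = 0"
      have 1: "sum u F = sum u (F \<union> F')" "sum u' F' = sum u' (F \<union> F')"
        by (rule sum.mono_neutral_left; use A in auto)+
      show "\<exists>K w. finite K \<and> K \<subseteq> I \<and> (\<forall>i. w i \<in> G i) \<and> (\<forall>i. i \<notin> K \<longrightarrow> w i = 0) \<and> sum u F + sum u' F' = sum w K"
        unfolding 1
        by (rule exI[of _ "F \<union> F'"], rule exI[of _ "\<lambda>i. u i + u' i"])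
          (use A in \<open>auto simp: component_closed sum.distrib\<close>)
    next
      fix c F u
      assume A: "finite F" "F \<subseteq> I" "\<forall>i. u i \<in> G i" "\<forall>i. i \<notin> F \<longrightarrow> u i = 0"
      show "\<exists>K w. finite K \<and> K \<subseteq> I \<and> (\<forall>i. w i \<in> G i) \<and> (\<forall>i. i \<notin> K \<longrightarrow> w i = 0) \<and> c *\<^sub>R sum u F = sum w K"
        by (rule exI[of _ "F"], rule exI[of _ "\<lambda>i. c *\<^sub>R u i"])
          (use A in \<open>auto simp: component_closed scaleR_right.sum\<close>)
    qed
  next
    fix i assume i: "i \<in> I"
    show "G i \<subseteq> ?T"
    proof
      fix x assume "x \<in> G i"
      then show "x \<in> ?T"
        by (intro CollectI exI[of _ "{i}"] exI[of _ "\<lambda>j. if j = i then x else 0"])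
          (use i in \<open>auto simp: component_closed\<close>)
    qed
  qed
  then show ?thesis using that by blast
qed

text \<open>By directness two decompositions of one element agree in each degree; here one has only
  negative and the other only nonnegative degrees.\<close>

lemma neg_nonneg_disjoint:
  assumes "x \<in> neg_space G" "x \<in> nonneg_space G"
  shows "x = 0"
proof -
  obtain F u where u: "finite F" "F \<subseteq> {..<0}" "\<And>i. u i \<in> G i" "\<And>i. i \<notin> F \<Longrightarrow> u i = 0" "x = (\<Sum>i\<in>F. u i)"
    using assms(1) by (rule graded_sum_decompose) blast
  obtain H v where v: "finite H" "H \<subseteq> {0..}" "\<And>i. v i \<in> G i" "\<And>i. i \<notin> H \<Longrightarrow> v i = 0" "x = (\<Sum>i\<in>H. v i)"
    using assms(2) by (rule graded_sum_decompose) blast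
  have 1: "sum u F = sum u (F \<union> H)" "sum v H = sum v (F \<union> H)"
    by (rule sum.mono_neutral_left; use u v in auto)+
  have "(\<Sum>i\<in>F \<union> H. u i - v i) = 0"
    using 1 u(5) v(5) by (simp add: sum_subtractf)
  then have "u i - v i = 0" if "i \<in> F \<union> H" for i
    using direct[of "F \<union> H" "\<lambda>i. u i - v i" i] u v that by (auto simp: component_closed)
  then have "u i = 0" if "i \<in> F" for i
    using that u(2) v(2) v(4)[of i] by force
  then show ?thesis using u(5) by simp
qed

text \<open>Negative arguments are the ones that occur below: an element of degree 0 maps the
  negative part into itself, so there the quotient action is the adjoint action.\<close>

lemma neg_part_neg:
  assumes "x \<in> neg_space G"
  shows "neg_part G x = x"
  unfolding neg_part_def
proof (rule the_equality)
  fix u assume u: "u \<in> neg_space G \<and> x - u \<in> nonneg_space G"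
  then have "x - u = 0"
    using assms by (intro neg_nonneg_disjoint) auto
  then show "u = x" by simp
qed (use assms in auto)

section \<open>1-cochains, the coboundary and its equivariance\<close>

text \<open>The counterpart of \<open>cochain_action\<close> on 1-cochains for \<open>A\<close> of
  degree 0, where \<open>br A\<close> already preserves the negative part.\<close>

definition act1 :: "'a \<Rightarrow> ('a \<Rightarrow> 'a) \<Rightarrow> 'a \<Rightarrow> 'a" where
  "act1 A \<psi> x = (if x \<in> neg_space G then br A (\<psi> x) - \<psi> (br A x) else 0)"

lemma cochains1D:
  assumes "\<psi> \<in> cochains1 G"
  shows "x \<in> neg_space G \<Longrightarrow> y \<in> neg_space G \<Longrightarrow> \<psi> (x + y) = \<psi> x + \<psi> y"
    "x \<in> neg_space G \<Longrightarrow> \<psi> (c *\<^sub>R x) = c *\<^sub>R \<psi> x"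
    "\<psi> x \<in> total_space G"
    "x \<notin> neg_space G \<Longrightarrow> \<psi> x = 0"
  using assms by (cases "x \<in> neg_space G"; auto simp: cochains1_def linear_on_def)+

lemma cochains1_minus:
  assumes "\<psi> \<in> cochains1 G" "x \<in> neg_space G"
  shows "\<psi> (- x) = - \<psi> x"
  using cochains1D(2)[OF assms, of "-1"] by simp

lemma act1_cochains1:
  assumes "\<psi> \<in> cochains1 G" "A \<in> G 0"
  shows "act1 A \<psi> \<in> cochains1 G"
  using cochains1D[OF assms(1)] component_total[OF assms(2)] br_deg0_neg[OF assms(2)]
  by (auto simp: cochains1_def linear_on_def act1_def br_linear neg_total algebra_simps)

lemma act1_cochains1_weight:
  assumes "\<psi> \<in> cochains1_weight G w" "A \<in> G 0"
  shows "act1 A \<psi> \<in> cochains1_weight G w"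
  unfolding cochains1_weight_def mem_Collect_eq
proof (intro conjI allI impI ballI)
  show "act1 A \<psi> \<in> cochains1 G"
    using assms act1_cochains1 by (auto simp: cochains1_weight_def)
  fix i x assume i: "i < 0" "x \<in> G i"
  have "\<psi> y \<in> G (i + w)" if "y \<in> G i" for y
    using that i assms(1) by (auto simp: cochains1_weight_def)
  then show "act1 A \<psi> x \<in> G (i + w)"
    using bracket_degree[OF assms(2), of _ "i + w"] bracket_degree[OF assms(2) i(2)] i component_neg
    by (auto simp: act1_def component_closed)
qed

lemma cochains1_weight_diff:
  assumes "\<phi> \<in> cochains1_weight G w" "\<psi> \<in> cochains1_weight G w"
  shows "(\<lambda>x. \<phi> x - \<psi> x) \<in> cochains1_weight G w"
  using assms by (auto simp: cochains1_weight_def cochains1_def linear_on_def algebra_simps component_closed)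

lemma cochains1_weight_zero: "(\<lambda>x. 0) \<in> cochains1_weight G w"
  by (auto simp: cochains1_weight_def cochains1_def linear_on_def component_closed)

lemma coboundary_weight:
  assumes "\<phi> \<in> cochains1_weight G w" "x \<in> G i" "y \<in> G j" "i < 0" "j < 0"
  shows "coboundary G br \<phi> x y \<in> G (i + j + w)"
proof -
  have 1: "\<phi> x \<in> G (i + w)" "\<phi> y \<in> G (j + w)" "\<phi> (br x y) \<in> G (i + j + w)"
    using assms bracket_degree[OF assms(2,3)] by (auto simp: cochains1_weight_def)
  show ?thesis
    using bracket_degree[OF assms(2) 1(2)] bracket_degree[OF assms(3) 1(1)] 1(3) assms component_neg
    by (auto simp: coboundary_def ac_simps intro!: component_closed)
qed

lemma coboundary_sum:
  assumes "\<And>w. w \<in> W \<Longrightarrow> \<phi> w \<in> cochains1 G"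
  shows "coboundary G br (\<lambda>x. \<Sum>w\<in>W. \<phi> w x) x y = (\<Sum>w\<in>W. coboundary G br (\<phi> w) x y)"
  using cochains1D(3)[OF assms]
  by (cases "x \<in> neg_space G \<and> y \<in> neg_space G")
    (auto simp: coboundary_def br_sum_right neg_total sum_subtractf)

lemma coboundary_diff:
  assumes "\<phi> \<in> cochains1 G" "\<psi> \<in> cochains1 G"
  shows "coboundary G br (\<lambda>x. \<phi> x - \<psi> x) x y = coboundary G br \<phi> x y - coboundary G br \<psi> x y"
  using cochains1D(3)[OF assms(1)] cochains1D(3)[OF assms(2)]
  by (simp add: coboundary_def br_linear neg_total)

text \<open>By the Jacobi identity \<open>br A\<close> is a derivation. The facts \<open>1\<close>,
  \<open>2\<close> and \<open>3\<close> apply this to the brackets from which the coboundary is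
  built.\<close>

lemma coboundary_equivariant:
  assumes "\<psi> \<in> cochains1 G" "A \<in> G 0"
  shows "cochain_action G br A (coboundary G br \<psi>) x y = coboundary G br (act1 A \<psi>) x y"
proof (cases "x \<in> neg_space G \<and> y \<in> neg_space G")
  case True
  then have x: "x \<in> neg_space G" and y: "y \<in> neg_space G" by auto
  note neg = x y br_neg[OF x y] br_deg0_neg[OF assms(2) x] br_deg0_neg[OF assms(2) y]
  note tot = neg[THEN neg_total] component_total[OF assms(2)] cochains1D(3)[OF assms(1)]
  have 1: "br A (br x y) = br (br A x) y + br x (br A y)"
    using tot by (intro jacobi_derivation) auto
  have 2: "br A (br x (\<psi> y)) = br (br A x) (\<psi> y) + br x (br A (\<psi> y))"
    "br A (br y (\<psi> x)) = br (br A y) (\<psi> x) + br y (br A (\<psi> x))"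
    using tot by (intro jacobi_derivation; simp)+
  have 3: "\<psi> (br A (br x y)) = \<psi> (br (br A x) y) + \<psi> (br x (br A y))"
    unfolding 1 by (rule cochains1D(1)[OF assms(1) br_neg[OF neg(4) y] br_neg[OF x neg(5)]])
  show ?thesis
    using tot neg
    by (simp add: cochain_action_def coboundary_def act1_def neg_part_neg 2 3 br_linear)
qed (auto simp: cochain_action_def coboundary_def)

lemma cochains2_posD:
  assumes "\<phi> \<in> cochains2_pos G"
  shows "\<phi> x y \<in> total_space G" "\<not> (x \<in> neg_space G \<and> y \<in> neg_space G) \<Longrightarrow> \<phi> x y = 0"
proof -
  obtain W \<psi> where W: "\<phi> = (\<lambda>x y. \<Sum>w\<in>W. \<psi> w x y)" "\<forall>w\<in>W. \<psi> w \<in> cochains2_weight G w"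
    using assms by (auto simp: cochains2_pos_def)
  have "\<psi> w x y \<in> total_space G \<and> (\<not> (x \<in> neg_space G \<and> y \<in> neg_space G) \<longrightarrow> \<psi> w x y = 0)" if "w \<in> W" for w
    using W(2) that
    by (cases "x \<in> neg_space G \<and> y \<in> neg_space G") (auto simp: cochains2_weight_def cochains2_def)
  then show "\<phi> x y \<in> total_space G" "\<not> (x \<in> neg_space G \<and> y \<in> neg_space G) \<Longrightarrow> \<phi> x y = 0"
    unfolding W(1) by (auto intro!: graded_sum_closed sum.neutral)
qed

lemma cochain_action_add:
  assumes "\<And>x y. \<phi> x y \<in> total_space G" "\<And>x y. \<psi> x y \<in> total_space G" "A \<in> G 0"
  shows "cochain_action G br A (\<lambda>x y. \<phi> x y + \<psi> x y) x y
    = cochain_action G br A \<phi> x y + cochain_action G br A \<psi> x y"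
  using assms component_total[OF assms(3)] by (simp add: cochain_action_def br_linear)

lemma coboundary_total:
  assumes "\<phi> \<in> cochains1 G"
  shows "coboundary G br \<phi> x y \<in> total_space G"
  using cochains1D(3)[OF assms] by (auto simp: coboundary_def neg_total)

section \<open>Splitting off the coboundaries over a degree-0 element\<close>

text \<open>Write \<open>\<phi>\<close> as \<open>\<nu>\<close> plus the coboundary of
  \<open>\<chi>\<close>, with \<open>\<nu>\<close> in \<open>N\<close>. By equivariance the action
  of \<open>A\<close> on \<open>\<nu>\<close> is the coboundary of
  \<open>\<psi>\<^sub>0 - act1 A \<chi>\<close>; by invariance it lies in \<open>N\<close>, so it
  vanishes. The required cochain is the weight \<open>w\<close> part of
  \<open>\<chi>\<close>.\<close>

lemma normalization_obstruction:
  assumes N: "linear_invariant_normalization G br N"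
    and A: "A \<in> G 0" and w: "w > 0"
    and \<phi>: "\<phi> \<in> cochains2_weight G w" and \<psi>0: "\<psi>\<^sub>0 \<in> cochains1_weight G w"
    and eq: "cochain_action G br A \<phi> = coboundary G br \<psi>\<^sub>0"
  obtains \<psi> where "\<psi> \<in> cochains1_weight G w"
    "\<And>i j x y. i < 0 \<Longrightarrow> j < 0 \<Longrightarrow> x \<in> G i \<Longrightarrow> y \<in> G j \<Longrightarrow>
       coboundary G br (\<lambda>x. act1 A \<psi> x - \<psi>\<^sub>0 x) x y = 0"
proof -
  have wc: "\<phi> \<in> cochains1_weight G v \<Longrightarrow> \<phi> \<in> cochains1 G" for \<phi> v
    by (simp add: cochains1_weight_def)
  have "\<phi> \<in> cochains2_pos G"
    unfolding cochains2_pos_def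
    by (rule CollectI, rule exI[of _ "{w}"], rule exI[of _ "\<lambda>_. \<phi>"]) (use w \<phi> in auto)
  moreover have "cochains2_pos G =
       {\<lambda>x y. \<phi> x y + coboundary G br \<psi> x y | \<phi> \<psi>. \<phi> \<in> N \<and> \<psi> \<in> cochains1_pos G}"
    using N unfolding linear_invariant_normalization_def by (elim conjE)
  ultimately obtain \<nu> \<chi> where \<nu>: "\<nu> \<in> N" and \<chi>: "\<chi> \<in> cochains1_pos G"
    and dec: "\<phi> = (\<lambda>x y. \<nu> x y + coboundary G br \<chi> x y)"
    by auto
  obtain W \<xi> where W: "finite W" "W \<subseteq> {0<..}" "\<And>v. v \<in> W \<Longrightarrow> \<xi> v \<in> cochains1_weight G v"
    and \<chi>_eq: "\<chi> = (\<lambda>x. \<Sum>v\<in>W. \<xi> v x)"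
    using \<chi> unfolding cochains1_pos_def by blast
  \<comment> \<open>Components of \<open>\<chi>\<close> in absent weights are set to 0, and
    \<open>w\<close> is forced into the index set, so that \<open>\<psi>\<^sub>0\<close> can be
    subtracted in weight \<open>w\<close>.\<close>
  define \<psi> where "\<psi> v = (if v \<in> W then \<xi> v else (\<lambda>x. 0))" for v
  define V where "V = insert w W"
  have \<psi>: "\<psi> v \<in> cochains1_weight G v" for v
    using W(3) by (auto simp: \<psi>_def cochains1_weight_zero)
  have V: "finite V" "W \<subseteq> V" "w \<in> V" "V \<subseteq> {0<..}"
    using W w by (auto simp: V_def)
  have \<chi>_eq': "\<chi> = (\<lambda>x. \<Sum>v\<in>V. \<psi> v x)"
    unfolding \<chi>_eq
    by (rule ext, rule sum.mono_neutral_cong_left) (use V in \<open>auto simp: \<psi>_def\<close>)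
  define \<rho> where "\<rho> v = (\<lambda>x. act1 A (\<psi> v) x - (if v = w then \<psi>\<^sub>0 x else 0))" for v
  have \<rho>: "\<rho> v \<in> cochains1_weight G v" for v
    unfolding \<rho>_def using act1_cochains1_weight[OF \<psi> A] \<psi>0 cochains1_weight_zero
    by (intro cochains1_weight_diff) (cases "v = w"; auto)+
  have sum_\<rho>: "(\<Sum>v\<in>V. \<rho> v x) = act1 A \<chi> x - \<psi>\<^sub>0 x" for x
    using V cochains1D(3)[OF wc[OF \<psi>]] component_total[OF A]
    by (simp add: \<rho>_def sum_subtractf act1_def \<chi>_eq' br_sum_right)
  have \<chi>1: "\<chi> \<in> cochains1 G"
    using wc[OF \<psi>] unfolding \<chi>_eq'
    by (auto simp: cochains1_def linear_on_def sum.distrib scaleR_right.sum)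
  have "A \<in> nonneg_space G"
    using A by (auto simp: graded_sum_def intro: span_base)
  moreover have "N \<subseteq> cochains2_pos G" "\<forall>a\<in>nonneg_space G. \<forall>\<phi>\<in>N. cochain_action G br a \<phi> \<in> N"
    "\<forall>c. \<forall>\<phi>\<in>N. (\<lambda>x y. c *\<^sub>R \<phi> x y) \<in> N"
    and N_int: "N \<inter> coboundary G br ` cochains1_pos G = {\<lambda>x y. 0}"
    using N unfolding linear_invariant_normalization_def by - (elim conjE, assumption)+
  ultimately have N_pos: "\<nu> \<in> cochains2_pos G" and N_act: "cochain_action G br A \<nu> \<in> N"
    and N_scale: "\<And>c \<phi>. \<phi> \<in> N \<Longrightarrow> (\<lambda>x y. c *\<^sub>R \<phi> x y) \<in> N"
    using \<nu> by auto
  have cob: "coboundary G br (\<lambda>x. \<Sum>v\<in>V. \<rho> v x) = (\<lambda>x y. (- 1) *\<^sub>R cochain_action G br A \<nu> x y)"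
  proof (intro ext)
    fix x y
    have "coboundary G br \<psi>\<^sub>0 x y = cochain_action G br A \<nu> x y + coboundary G br (act1 A \<chi>) x y"
      using cochain_action_add[of \<nu> "coboundary G br \<chi>" A x y,
          OF cochains2_posD(1)[OF N_pos] coboundary_total[OF \<chi>1] A]
      unfolding eq[symmetric] dec coboundary_equivariant[OF \<chi>1 A] .
    then show "coboundary G br (\<lambda>x. \<Sum>v\<in>V. \<rho> v x) x y = (- 1) *\<^sub>R cochain_action G br A \<nu> x y"
      unfolding sum_\<rho>
      by (simp add: coboundary_diff[OF act1_cochains1[OF \<chi>1 A] wc[OF \<psi>0]])
  qed
  have "(\<lambda>x. \<Sum>v\<in>V. \<rho> v x) \<in> cochains1_pos G"
    unfolding cochains1_pos_def
    by (rule CollectI, rule exI[of _ V], rule exI[of _ \<rho>]) (use V \<rho> in auto)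
  moreover have "coboundary G br (\<lambda>x. \<Sum>v\<in>V. \<rho> v x) \<in> N"
    unfolding cob by (rule N_scale[OF N_act])
  ultimately have "coboundary G br (\<lambda>x. \<Sum>v\<in>V. \<rho> v x) \<in> {\<lambda>x y. 0}"
    unfolding N_int[symmetric] by (intro IntI imageI)
  then have zero: "coboundary G br (\<lambda>x. \<Sum>v\<in>V. \<rho> v x) x y = 0" for x y
    by simp
  show ?thesis
  proof (rule that[of "\<psi> w"])
    show "\<psi> w \<in> cochains1_weight G w" by (rule \<psi>)
    fix i j x y assume ij: "i < 0" "j < 0" "x \<in> G i" "y \<in> G j"
    \<comment> \<open>Weights are reindexed by the degree \<open>l = i + j + v\<close> of the value
      at \<open>x\<close>, \<open>y\<close>; directness then isolates weight
      \<open>w\<close>.\<close>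
    define d where "d l = coboundary G br (\<rho> (l - i - j)) x y" for l
    have "(\<Sum>l\<in>(\<lambda>v. i + j + v) ` V. d l) = (\<Sum>v\<in>V. coboundary G br (\<rho> v) x y)"
      by (subst sum.reindex) (auto simp: d_def inj_on_def)
    also have "\<dots> = 0"
      using zero[of x y] coboundary_sum[of V \<rho> x y] wc[OF \<rho>] by simp
    finally have sum_d: "(\<Sum>l\<in>(\<lambda>v. i + j + v) ` V. d l) = 0" .
    have "d l \<in> G l" for l
      using coboundary_weight[OF \<rho>[of "l - i - j"] ij(3,4,1,2)] by (simp add: d_def)
    then have "d (i + j + w) = 0"
      by (rule direct[OF finite_imageI[OF V(1)] _ sum_d imageI[OF V(3)]])
    then show "coboundary G br (\<lambda>x. act1 A (\<psi> w) x - \<psi>\<^sub>0 x) x y = 0"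
      by (simp add: d_def \<rho>_def)
  qed
qed

end

section \<open>The ambient Lie bracket\<close>

lemma lookup_scaleR [simp]:
  "Poly_Mapping.lookup (c *\<^sub>R x) b = c *\<^sub>R Poly_Mapping.lookup x b" for x :: "'b \<Rightarrow>\<^sub>0 real"
proof -
  have "finite {i. c *\<^sub>R Poly_Mapping.lookup x i \<noteq> 0}"
    by (rule finite_subset[OF _ finite_lookup[of x]]) auto
  then show ?thesis
    by (simp add: scaleR_poly_mapping_def)
qed

lemma basis_vec_neq_0 [simp]: "basis_vec b \<noteq> 0"
  by (metis lookup_single_eq lookup_zero zero_neq_one)

lemma basis_expansion:
  fixes x :: ambient
  assumes "finite A" "Poly_Mapping.keys x \<subseteq> A"
  shows "x = (\<Sum>b\<in>A. Poly_Mapping.lookup x b *\<^sub>R basis_vec b)"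
proof (rule poly_mapping_eqI)
  fix b
  have "(\<Sum>c\<in>A. Poly_Mapping.lookup x c * (1 when c = b)) = (\<Sum>c\<in>A. if c = b then Poly_Mapping.lookup x b else 0)"
    by (rule sum.cong) auto
  also have "\<dots> = Poly_Mapping.lookup x b"
    using assms by (auto simp: in_keys_iff)
  finally show "Poly_Mapping.lookup x b = Poly_Mapping.lookup (\<Sum>b\<in>A. Poly_Mapping.lookup x b *\<^sub>R basis_vec b) b"
    by (simp add: lookup_sum lookup_single)
qed

lemma span_basis_vec: "span (basis_vec ` B) = {x. Poly_Mapping.keys x \<subseteq> B}"
proof
  have "subspace {x :: ambient. Poly_Mapping.keys x \<subseteq> B}"
    by (auto simp: subspace_def in_keys_iff lookup_add subset_iff) (metis add_0)
  then show "span (basis_vec ` B) \<subseteq> {x. Poly_Mapping.keys x \<subseteq> B}"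
    by (intro span_minimal) auto
  show "{x. Poly_Mapping.keys x \<subseteq> B} \<subseteq> span (basis_vec ` B)"
  proof
    fix x :: ambient assume "x \<in> {x. Poly_Mapping.keys x \<subseteq> B}"
    then have "(\<Sum>b\<in>Poly_Mapping.keys x. Poly_Mapping.lookup x b *\<^sub>R basis_vec b) \<in> span (basis_vec ` B)"
      by (intro span_sum span_scale span_base) auto
    then show "x \<in> span (basis_vec ` B)"
      using basis_expansion[of "Poly_Mapping.keys x" x] by simp
  qed
qed

text \<open>Supports change under addition and scaling. Summing over any finite supersets of the
  supports puts the brackets to be compared over common index sets.\<close>

lemma gl2_bracket_expand:
  assumes "finite A" "Poly_Mapping.keys u \<subseteq> A" "finite B" "Poly_Mapping.keys v \<subseteq> B"
  shows "gl2_heis_bracket n u v =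
    (\<Sum>a\<in>A. \<Sum>b\<in>B. (Poly_Mapping.lookup u a * Poly_Mapping.lookup v b) *\<^sub>R gen_bracket n a b)"
proof -
  have "gl2_heis_bracket n u v =
    (\<Sum>a\<in>Poly_Mapping.keys u. \<Sum>b\<in>B. (Poly_Mapping.lookup u a * Poly_Mapping.lookup v b) *\<^sub>R gen_bracket n a b)"
    unfolding gl2_heis_bracket_def
    by (rule sum.cong[OF refl], rule sum.mono_neutral_left) (use assms in \<open>auto simp: in_keys_iff\<close>)
  also have "\<dots> = (\<Sum>a\<in>A. \<Sum>b\<in>B. (Poly_Mapping.lookup u a * Poly_Mapping.lookup v b) *\<^sub>R gen_bracket n a b)"
    by (rule sum.mono_neutral_left) (use assms in \<open>auto simp: in_keys_iff\<close>)
  finally show ?thesis .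
qed

lemma linear_gl2_bracket_left: "linear (\<lambda>u. gl2_heis_bracket n u v)"
proof (rule linearI)
  fix u u' :: ambient and c :: real
  let ?A = "Poly_Mapping.keys u \<union> Poly_Mapping.keys u'" and ?B = "Poly_Mapping.keys v"
  have k: "Poly_Mapping.keys (u + u') \<subseteq> ?A" "Poly_Mapping.keys (c *\<^sub>R u) \<subseteq> Poly_Mapping.keys u"
    using keys_add[of u u'] by (auto simp: in_keys_iff)
  show "gl2_heis_bracket n (u + u') v = gl2_heis_bracket n u v + gl2_heis_bracket n u' v"
    using k by (simp add: gl2_bracket_expand[of ?A _ ?B] lookup_add distrib_right scaleR_add_left sum.distrib)
  show "gl2_heis_bracket n (c *\<^sub>R u) v = c *\<^sub>R gl2_heis_bracket n u v"
    using k by (simp add: gl2_bracket_expand[of "Poly_Mapping.keys u" _ ?B] scaleR_right.sum ac_simps)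
qed

lemma linear_gl2_bracket_right: "linear (gl2_heis_bracket n u)"
proof (rule linearI)
  fix v v' :: ambient and c :: real
  let ?A = "Poly_Mapping.keys v \<union> Poly_Mapping.keys v'" and ?B = "Poly_Mapping.keys u"
  have k: "Poly_Mapping.keys (v + v') \<subseteq> ?A" "Poly_Mapping.keys (c *\<^sub>R v) \<subseteq> Poly_Mapping.keys v"
    using keys_add[of v v'] by (auto simp: in_keys_iff)
  show "gl2_heis_bracket n u (v + v') = gl2_heis_bracket n u v + gl2_heis_bracket n u v'"
    using k by (simp add: gl2_bracket_expand[of ?B _ ?A] lookup_add distrib_left scaleR_add_left sum.distrib)
  show "gl2_heis_bracket n u (c *\<^sub>R v) = c *\<^sub>R gl2_heis_bracket n u v"
    using k by (simp add: gl2_bracket_expand[of ?B _ "Poly_Mapping.keys v"] scaleR_right.sum ac_simps)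
qed

lemmas gl2_bracket_linear =
  linear_add[OF linear_gl2_bracket_left] linear_add[OF linear_gl2_bracket_right]
  linear_diff[OF linear_gl2_bracket_left] linear_diff[OF linear_gl2_bracket_right]
  linear_neg[OF linear_gl2_bracket_left] linear_neg[OF linear_gl2_bracket_right]
  linear_cmul[OF linear_gl2_bracket_left] linear_cmul[OF linear_gl2_bracket_right]
  linear_0[OF linear_gl2_bracket_left] linear_0[OF linear_gl2_bracket_right]

lemma gl2_bracket_basis [simp]: "gl2_heis_bracket n (basis_vec a) (basis_vec b) = gen_bracket n a b"
  by (simp add: gl2_heis_bracket_def)

lemma bilinear_on_span:
  assumes "x \<in> span A" "y \<in> span B" "\<And>y. linear (\<lambda>x. f x y)" "\<And>x. linear (f x)"
    and "\<And>a b. a \<in> A \<Longrightarrow> b \<in> B \<Longrightarrow> f a b \<in> S" and "subspace S"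
  shows "f x y \<in> S"
proof -
  have sub: "subspace {x. f x y \<in> S}" for y
    using assms(3,6) by (simp add: linear_subspace_vimage flip: vimage_def)
  have sub': "subspace {y. f x y \<in> S}" for x
    using assms(4,6) by (simp add: linear_subspace_vimage flip: vimage_def)
  have "f a y \<in> S" if "a \<in> A" for a
    using span_minimal[OF _ sub'[of a], of B] assms(2,5) that by blast
  then show ?thesis
    using span_minimal[OF _ sub[of y], of A] assms(1) by blast
qed

text \<open>A nonzero bracket of \<epsilon>_i and \<epsilon>_j has i + j = 2n - 5, which is odd, so
  (-1)^i and (-1)^j are opposite.\<close>

lemma gen_bracket_antisym: "gen_bracket n a b = - gen_bracket n b a"
proof -
  have "(-1::real) ^ i = - ((-1) ^ j)" if "i + j + 5 = 2 * n" for i j :: nat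
  proof -
    have "even i \<longleftrightarrow> odd j"
      using that by presburger
    then show ?thesis by (auto simp: uminus_power_if)
  qed
  then show ?thesis
    by (cases a; cases b) (auto simp: add.commute)
qed

lemma gl2_bracket_antisym: "gl2_heis_bracket n u v = - gl2_heis_bracket n v u"
  unfolding gl2_heis_bracket_def
  by (subst sum.swap) (subst gen_bracket_antisym, simp add: sum_negf mult.commute)

lemma gl2_bracket_self: "gl2_heis_bracket n u u = 0"
proof -
  have "2 *\<^sub>R gl2_heis_bracket n u u = 0"
    using gl2_bracket_antisym[of n u u] unfolding scaleR_2 by (simp add: eq_neg_iff_add_eq_0)
  then show ?thesis by simp
qed

section \<open>The extension of the symbol by \<open>e\<^sub>0\<close>\<close>

text \<open>For n > 5 and k \<le> n - 5 the natural subtraction is exact and gives the index, at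
  least 1, of the \<epsilon> of weight 0.\<close>

definition ext_gens :: "nat \<Rightarrow> nat \<Rightarrow> gen set" where
  "ext_gens k n = insert (genEps (n - 4 - k)) {b \<in> gl2_heis_gens n. wght k n b < 0}"

definition ext_grading :: "nat \<Rightarrow> nat \<Rightarrow> int \<Rightarrow> ambient set" where
  "ext_grading k n i = span (basis_vec ` {b \<in> ext_gens k n. wght k n b = i})"

lemma subspace_ext_grading: "subspace (ext_grading k n i)"
  by (simp add: ext_grading_def)

lemma graded_sum_basis:
  "graded_sum (\<lambda>i. span (basis_vec ` {b \<in> S. wt b = i})) I = {x. Poly_Mapping.keys x \<subseteq> {b \<in> S. wt b \<in> I}}"
proof -
  have "(\<Union>i\<in>I. basis_vec ` {b \<in> S. wt b = i}) = basis_vec ` {b \<in> S. wt b \<in> I}"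
    by auto
  moreover have "span (\<Union>i\<in>I. span (F i)) = span (\<Union>i\<in>I. F i)" for F :: "int \<Rightarrow> ambient set"
  proof
    show "span (\<Union>i\<in>I. F i) \<subseteq> span (\<Union>i\<in>I. span (F i))"
      by (rule span_mono) (auto intro: span_base)
    show "span (\<Union>i\<in>I. span (F i)) \<subseteq> span (\<Union>i\<in>I. F i)"
      by (rule span_minimal) (auto intro: subsetD[OF span_mono])
  qed
  ultimately show ?thesis
    unfolding graded_sum_def span_basis_vec[symmetric] by simp
qed

locale symbol_params =
  fixes n k :: nat
  assumes n_gt: "n > 5" and k_le: "k \<le> n - 5"
begin

lemma ext_gens_cases:
  assumes "b \<in> ext_gens k n"
  obtains "b = genX" | "b = genEta" | i where "b = genEps i" "n - 4 - k \<le> i" "i \<le> 2 * n - 6"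
  using assms n_gt k_le by (auto simp: ext_gens_def gl2_heis_gens_def)

text \<open>The case with content is X together with \<epsilon>_i and \<epsilon>_j, i + j = 2n - 6:
  the two nonzero terms are -(-1)^i \<eta> and (-1)^j \<eta>, and i, j have equal parity. As all
  indices are at least 1, neither is 2n - 6 here, so the boundary value [X, \<epsilon>_(2n-6)] = 0
  does not interfere.\<close>

lemma ext_gens_jacobi:
  assumes "a \<in> ext_gens k n" "b \<in> ext_gens k n" "c \<in> ext_gens k n"
  shows "gl2_heis_bracket n (basis_vec a) (gen_bracket n b c)
    + gl2_heis_bracket n (basis_vec b) (gen_bracket n c a)
    + gl2_heis_bracket n (basis_vec c) (gen_bracket n a b) = 0"
proof -
  have parity: "(-1::real) ^ i = (-1) ^ j" if "Suc (i + j + 5) = 2 * n" for i j :: nat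
  proof -
    have "even i \<longleftrightarrow> even j"
      using that by presburger
    then show ?thesis by (auto simp: uminus_power_if)
  qed
  show ?thesis
    using assms(1)
  proof (cases rule: ext_gens_cases)
    case a: 1
    show ?thesis
      using assms(2)
    proof (cases rule: ext_gens_cases)
      case 1
      show ?thesis
        using assms(3) by (cases rule: ext_gens_cases) (use a 1 in \<open>auto simp: gl2_bracket_linear\<close>)
    next
      case 2
      show ?thesis
        using assms(3) by (cases rule: ext_gens_cases) (use a 2 in \<open>auto simp: gl2_bracket_linear\<close>)
    next
      case (3 i)
      show ?thesis
        using assms(3)
        by (cases rule: ext_gens_cases)
          (use a 3 n_gt k_le parity[of i, symmetric] in \<open>auto simp: gl2_bracket_linear add.commute\<close>)
    qed
  next
    case a: 2
    show ?thesis
      using assms(2)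
    proof (cases rule: ext_gens_cases)
      case 1
      show ?thesis
        using assms(3) by (cases rule: ext_gens_cases) (use a 1 in \<open>auto simp: gl2_bracket_linear\<close>)
    next
      case 2
      show ?thesis
        using assms(3) by (cases rule: ext_gens_cases) (use a 2 in \<open>auto simp: gl2_bracket_linear\<close>)
    next
      case (3 i)
      show ?thesis
        using assms(3) by (cases rule: ext_gens_cases) (use a 3 in \<open>auto simp: gl2_bracket_linear\<close>)
    qed
  next
    case a: (3 h)
    show ?thesis
      using assms(2)
    proof (cases rule: ext_gens_cases)
      case 1
      show ?thesis
        using assms(3)
        by (cases rule: ext_gens_cases)
          (use a 1 n_gt k_le parity[of h] in \<open>auto simp: gl2_bracket_linear add.commute\<close>)
    next
      case 2
      show ?thesis
        using assms(3) by (cases rule: ext_gens_cases) (use a 2 in \<open>auto simp: gl2_bracket_linear\<close>)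
    next
      case (3 i)
      show ?thesis
        using assms(3)
        by (cases rule: ext_gens_cases)
          (use a 3 n_gt k_le parity[of h i] parity[of i h] in \<open>auto simp: gl2_bracket_linear add.commute\<close>)
    qed
  qed
qed

lemma ext_jacobi:
  assumes "x \<in> span (basis_vec ` ext_gens k n)" "y \<in> span (basis_vec ` ext_gens k n)"
    "z \<in> span (basis_vec ` ext_gens k n)"
  shows "gl2_heis_bracket n x (gl2_heis_bracket n y z) + gl2_heis_bracket n y (gl2_heis_bracket n z x)
    + gl2_heis_bracket n z (gl2_heis_bracket n x y) = 0" (is "?J x y z = 0")
proof -
  have lin: "linear (\<lambda>x. ?J x y z)" "linear (\<lambda>y. ?J x y z)" "linear (?J x y)" for x y z
    by (auto intro!: linearI simp: gl2_bracket_linear algebra_simps scaleR_add_right)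
  have "?J x y c \<in> {0}" if "c \<in> basis_vec ` ext_gens k n" for c
    using assms(1,2)
    by (rule bilinear_on_span[where f = "\<lambda>x y. ?J x y c"])
      (use that ext_gens_jacobi lin in auto)
  then show ?thesis
    using linear_eq_0_on_span[OF lin(3) _ assms(3), of x y] by blast
qed

lemma gen_bracket_degree:
  assumes "a \<in> ext_gens k n" "b \<in> ext_gens k n"
  shows "gen_bracket n a b \<in> ext_grading k n (wght k n a + wght k n b)"
proof -
  have z: "0 \<in> ext_grading k n i" for i
    by (simp add: ext_grading_def span_0)
  have s: "c *\<^sub>R x \<in> ext_grading k n i" "- x \<in> ext_grading k n i" if "x \<in> ext_grading k n i" for x c i
    using that by (simp_all add: ext_grading_def span_scale span_neg)
  have b: "basis_vec b \<in> ext_grading k n i" if "b \<in> ext_gens k n" "wght k n b = i" for b i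
    using that by (auto simp: ext_grading_def intro: span_base)
  have eta: "genEta \<in> ext_gens k n"
    by (auto simp: ext_gens_def gl2_heis_gens_def)
  have eps: "genEps (Suc i) \<in> ext_gens k n" if "genEps i \<in> ext_gens k n" "i + 7 \<le> 2 * n" for i
    using that n_gt k_le by (auto simp: ext_gens_def gl2_heis_gens_def)
  note H = z s b eta eps
  show ?thesis
    using assms(1)
  proof (cases rule: ext_gens_cases)
    case a: 1
    show ?thesis
      using assms(2) by (cases rule: ext_gens_cases) (use a n_gt k_le assms in \<open>auto intro!: H\<close>)
  next
    case a: 2
    show ?thesis
      using assms(2) by (cases rule: ext_gens_cases) (use a n_gt k_le assms in \<open>auto intro!: H\<close>)
  next
    case a: 3
    show ?thesis
      using assms(2) by (cases rule: ext_gens_cases) (use a n_gt k_le assms in \<open>auto intro!: H\<close>)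
  qed
qed

lemma ext_total: "total_space (ext_grading k n) = span (basis_vec ` ext_gens k n)"
  unfolding ext_grading_def[abs_def] graded_sum_basis by (simp add: span_basis_vec)

lemma ext_graded_lie_algebra: "graded_lie_algebra (ext_grading k n) (gl2_heis_bracket n)"
proof
  show "subspace (ext_grading k n i)" for i
    by (rule subspace_ext_grading)
next
  fix I :: "int set" and u j
  assume I: "finite I" "\<And>i. i \<in> I \<Longrightarrow> u i \<in> ext_grading k n i" "(\<Sum>i\<in>I. u i) = 0" "j \<in> I"
  \<comment> \<open>Directness: the coordinate at \<open>b\<close> occurs only in the summand of
    degree \<open>wght k n b\<close>.\<close>
  have z: "Poly_Mapping.lookup (u i) b = 0" if "i \<in> I" "wght k n b \<noteq> i" for i b
    using I(2)[OF that(1)] that(2) by (auto simp: ext_grading_def span_basis_vec in_keys_iff)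
  show "u j = 0"
  proof (rule poly_mapping_eqI)
    fix b
    have "0 = (\<Sum>i\<in>I. Poly_Mapping.lookup (u i) b)"
      using I(3) by (metis lookup_sum lookup_zero)
    also have "\<dots> = (\<Sum>i\<in>I. if i = wght k n b then Poly_Mapping.lookup (u i) b else 0)"
      by (rule sum.cong) (auto simp: z)
    finally show "Poly_Mapping.lookup (u j) b = Poly_Mapping.lookup 0 b"
      using I(1,4) z[of j b] by (cases "wght k n b = j") auto
  qed
next
  show "linear_on (total_space (ext_grading k n)) (\<lambda>x. gl2_heis_bracket n x y)" for y
    by (simp add: linear_on_def gl2_bracket_linear)
  show "linear_on (total_space (ext_grading k n)) (gl2_heis_bracket n x)" for x
    by (simp add: linear_on_def gl2_bracket_linear)
  show "gl2_heis_bracket n x x = 0" for x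
    by (rule gl2_bracket_self)
  show "gl2_heis_bracket n x (gl2_heis_bracket n y z) + gl2_heis_bracket n y (gl2_heis_bracket n z x)
    + gl2_heis_bracket n z (gl2_heis_bracket n x y) = 0"
    if "x \<in> total_space (ext_grading k n)" "y \<in> total_space (ext_grading k n)"
      "z \<in> total_space (ext_grading k n)" for x y z
    using that ext_jacobi unfolding ext_total by blast
  show "gl2_heis_bracket n x y \<in> ext_grading k n (i + j)"
    if "x \<in> ext_grading k n i" "y \<in> ext_grading k n j" for x y i j
    using that(1,2) unfolding ext_grading_def[of k n i] ext_grading_def[of k n j]
    by (rule bilinear_on_span)
      (use gen_bracket_degree subspace_ext_grading in \<open>auto simp: linear_gl2_bracket_left linear_gl2_bracket_right\<close>)
qed

lemma wght_e0: "wght k n (genEps (n - 4 - k)) = 0"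
  using n_gt k_le by simp

lemma ext_neg: "i < 0 \<Longrightarrow> ext_grading k n i = symbol_grading k n i"
  using wght_e0 unfolding ext_grading_def symbol_grading_def gl2_heis_grading_def
  by (auto simp: ext_gens_def intro!: arg_cong[of _ _ span] arg_cong[of _ _ "image basis_vec"])

lemma ext_zero: "ext_grading k n 0 = span {basis_vec (genEps (n - 4 - k))}"
proof -
  have "{b \<in> ext_gens k n. wght k n b = 0} = {genEps (n - 4 - k)}"
    using wght_e0 by (auto simp: ext_gens_def)
  then show ?thesis by (simp add: ext_grading_def)
qed

lemma ext_pos: "i > 0 \<Longrightarrow> ext_grading k n i = {0}"
proof -
  assume "i > 0"
  then have "{b \<in> ext_gens k n. wght k n b = i} = {}"
    using wght_e0 by (auto simp: ext_gens_def simp del: wght.simps)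
  then show ?thesis by (simp only: ext_grading_def) simp
qed

text \<open>The nonnegative part is the line of e_0, which X detects through [e_0, X] =
  -e_1.\<close>

lemma ext_tanaka: "tanaka_extension (symbol_grading k n) (gl2_heis_bracket n) (ext_grading k n) (gl2_heis_bracket n)"
  unfolding tanaka_extension_def
proof (intro conjI allI impI ballI ext_graded_lie_algebra)
  show "i < 0 \<Longrightarrow> ext_grading k n i = symbol_grading k n i" for i by (rule ext_neg)
  fix i :: int and x assume i: "0 \<le> i" "x \<in> ext_grading k n i"
    and x: "\<forall>y\<in>ext_grading k n (- 1). gl2_heis_bracket n x y = 0"
  show "x = 0"
  proof (cases "i = 0")
    case True
    then obtain c where c: "x = c *\<^sub>R basis_vec (genEps (n - 4 - k))"
      using i(2) by (auto simp: ext_zero span_singleton)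
    have "basis_vec genX \<in> ext_grading k n (- 1)"
      by (auto simp: ext_grading_def ext_gens_def gl2_heis_gens_def intro!: span_base)
    then have "gl2_heis_bracket n x (basis_vec genX) = 0"
      using x by blast
    moreover have "gen_bracket n (genEps (n - 4 - k)) genX = - basis_vec (genEps (n - 4 - k + 1))"
      unfolding gen_bracket.simps using n_gt by auto
    ultimately have "c *\<^sub>R - basis_vec (genEps (n - 4 - k + 1)) = 0"
      by (simp only: c gl2_bracket_linear gl2_bracket_basis)
    then show ?thesis by (simp add: c)
  next
    case False
    then show ?thesis using i ext_pos by auto
  qed
qed auto

end

section \<open>The prolongation in degrees at most 0\<close>

locale symbol_prolongation = symbol_params n k + graded_lie_algebra G br
  for n k :: nat and G :: "int \<Rightarrow> ambient set" and br :: "ambient \<Rightarrow> ambient \<Rightarrow> ambient" +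
  assumes universal: "universal_tanaka_prolongation (symbol_grading k n) (gl2_heis_bracket n) G br"
begin

text \<open>\<open>m\<close> is the index of the \<open>\<epsilon>\<close> of weight 0.\<close>

definition m :: nat where "m = n - 4 - k"
definition e :: "nat \<Rightarrow> ambient" where "e i = basis_vec (genEps (m + i))"
abbreviation X :: ambient where "X \<equiv> basis_vec genX"
abbreviation \<eta> :: ambient where "\<eta> \<equiv> basis_vec genEta"
abbreviation p :: nat where "p \<equiv> 2 * k + 3"
text \<open>The sign left over from shifting the index by \<open>m\<close>: the bracket of
  \<open>e i\<close> and \<open>e j\<close> with i + j = p is \<sigma> (-1)^i \<eta>.\<close>

definition \<sigma> :: real where "\<sigma> = (- 1) ^ m"

abbreviation coordX :: "ambient \<Rightarrow> real" where "coordX x \<equiv> Poly_Mapping.lookup x genX"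
abbreviation coord\<eta> :: "ambient \<Rightarrow> real" where "coord\<eta> x \<equiv> Poly_Mapping.lookup x genEta"
definition coord :: "nat \<Rightarrow> ambient \<Rightarrow> real" where
  "coord i x = Poly_Mapping.lookup x (genEps (m + i))"

section \<open>Coordinates and brackets of the negative part\<close>

lemma n_eq: "n = m + k + 4"
  using n_gt k_le by (auto simp: m_def)

lemma coord_basis [simp]:
  "coordX X = 1" "coordX \<eta> = 0" "coordX (e i) = 0"
  "coord\<eta> X = 0" "coord\<eta> \<eta> = 1" "coord\<eta> (e i) = 0"
  "coord i X = 0" "coord i \<eta> = 0" "coord i (e j) = (if i = j then 1 else 0)"
  by (auto simp: e_def coord_def lookup_single)

lemma coord_linear [simp]:
  "coord i 0 = 0" "coord i (- x) = - coord i x" "coord i (c *\<^sub>R x) = c * coord i x"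
  "coord i (x + y) = coord i x + coord i y" "coord i (x - y) = coord i x - coord i y"
  by (simp_all add: coord_def lookup_add lookup_minus)

lemma sigma_sigma: "\<sigma> * (\<sigma> * r) = r"
  by (simp add: \<sigma>_def flip: mult.assoc power_mult_distrib)

lemma neg_component: "i < 0 \<Longrightarrow> G i = ext_grading k n i"
  using universal ext_neg by (simp add: universal_tanaka_prolongation_def tanaka_extension_def)

lemma neg_space_eq: "neg_space G = span (basis_vec ` {b \<in> ext_gens k n. wght k n b < 0})"
proof -
  have "neg_space G = neg_space (ext_grading k n)"
    by (simp add: graded_sum_def neg_component)
  also have "\<dots> = span (basis_vec ` {b \<in> ext_gens k n. wght k n b < 0})"
    unfolding ext_grading_def[abs_def] graded_sum_basis by (simp add: span_basis_vec)
  finally show ?thesis .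
qed

lemma neg_bracket:
  assumes "x \<in> neg_space G" "y \<in> neg_space G"
  shows "br x y = gl2_heis_bracket n x y"
proof -
  have "neg_space G = neg_space (symbol_grading k n)"
    by (simp add: graded_sum_def neg_component ext_neg)
  then show ?thesis
    using assms universal by (simp add: universal_tanaka_prolongation_def tanaka_extension_def)
qed

lemma neg_component_coord:
  assumes "x \<in> G i" "i < 0" "Poly_Mapping.lookup x b \<noteq> 0"
  shows "wght k n b = i"
  using assms by (auto simp: neg_component ext_grading_def span_basis_vec in_keys_iff)

lemma neg_component_basis:
  assumes "b \<in> ext_gens k n" "wght k n b = i" "i < 0"
  shows "basis_vec b \<in> G i"
  using assms by (auto simp: neg_component ext_grading_def intro: span_base)

lemma X_G: "X \<in> G (- 1)"
  by (rule neg_component_basis) (auto simp: ext_gens_def gl2_heis_gens_def)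

lemma eta_G: "\<eta> \<in> G (- int p)"
  by (rule neg_component_basis) (auto simp: ext_gens_def gl2_heis_gens_def)

text \<open>The upper bound is 2n - 6 - m, which is reached at the last \<epsilon> of the
  algebra.\<close>

lemma e_G: "1 \<le> i \<Longrightarrow> i \<le> n - 2 + k \<Longrightarrow> e i \<in> G (- int i)"
  unfolding e_def
  by (rule neg_component_basis) (use n_gt k_le n_eq in \<open>auto simp: ext_gens_def gl2_heis_gens_def intro!: imageI\<close>)

lemmas X_neg [simp] = component_neg[OF X_G, simplified]
lemma eta_neg [simp]: "\<eta> \<in> neg_space G" by (rule component_neg[OF eta_G]) simp
lemma e_neg: "1 \<le> i \<Longrightarrow> i \<le> n - 2 + k \<Longrightarrow> e i \<in> neg_space G" by (rule component_neg[OF e_G]) auto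

lemma br_X_e: "1 \<le> i \<Longrightarrow> i < n - 2 + k \<Longrightarrow> br X (e i) = e (i + 1)"
  using e_neg[of i] n_gt n_eq by (simp add: neg_bracket e_def)

lemma br_X_e_top: "i = n - 2 + k \<Longrightarrow> br X (e i) = 0"
  using e_neg[of i] n_gt n_eq by (simp add: neg_bracket e_def)

lemma br_e_e:
  assumes "1 \<le> i" "1 \<le> j" "i \<le> n - 2 + k" "j \<le> n - 2 + k"
  shows "br (e i) (e j) = (if i + j = p then (\<sigma> * (- 1) ^ i) *\<^sub>R \<eta> else 0)"
proof -
  have "m + i + (m + j) + 5 = 2 * n \<longleftrightarrow> i + j = p"
    using n_eq by auto
  then show ?thesis
    using e_neg[of i] e_neg[of j] assms by (simp add: neg_bracket e_def \<sigma>_def power_add)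
qed

lemma br_X_eta: "br X \<eta> = 0"
  by (simp add: neg_bracket)

lemma br_e_eta: "1 \<le> i \<Longrightarrow> i \<le> n - 2 + k \<Longrightarrow> br (e i) \<eta> = 0"
  using e_neg[of i] by (simp add: neg_bracket e_def)

text \<open>Apart from \<open>X\<close> and \<open>e 1\<close> no generator has weight -1; in
  particular \<open>\<eta>\<close> has weight -p \<le> -3.\<close>

lemma G_minus_one:
  assumes "x \<in> G (- 1)"
  shows "x = coordX x *\<^sub>R X + coord 1 x *\<^sub>R e 1"
proof (rule poly_mapping_eqI)
  fix b
  have "Poly_Mapping.lookup x b = 0" if "b \<noteq> genX" "b \<noteq> genEps (m + 1)"
  proof (rule ccontr)
    assume nz: "Poly_Mapping.lookup x b \<noteq> 0"
    then have "b \<in> ext_gens k n"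
      using assms by (auto simp: neg_component ext_grading_def span_basis_vec in_keys_iff)
    then show False
      using neg_component_coord[OF assms _ nz] that n_eq by (cases rule: ext_gens_cases) auto
  qed
  then show "Poly_Mapping.lookup x b = Poly_Mapping.lookup (coordX x *\<^sub>R X + coord 1 x *\<^sub>R e 1) b"
    by (cases "b = genX \<or> b = genEps (m + 1)") (auto simp: lookup_add lookup_single e_def coord_def)
qed

section \<open>The element e_0 inside the prolongation\<close>

text \<open>On the negative part this is the bracket with e_0, extended linearly to the ambient
  space. Its image lies in the span of \<open>e 1\<close> and \<open>\<eta>\<close>, from which the
  final equations arise.\<close>

definition T :: "ambient \<Rightarrow> ambient" where
  "T x = - coordX x *\<^sub>R e 1 + (\<sigma> * coord p x) *\<^sub>R \<eta>"

lemma linear_T: "linear T"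
  by (rule linearI) (simp_all add: T_def lookup_add algebra_simps)

lemma T_simps [simp]: "T X = - e 1" "T \<eta> = 0" "T (e i) = (if i = p then \<sigma> *\<^sub>R \<eta> else 0)" "T 0 = 0"
  by (simp_all add: T_def)

lemma bracket_e0:
  assumes "x \<in> neg_space G"
  shows "gl2_heis_bracket n (basis_vec (genEps m)) x = T x"
proof (rule linear_eq_on[OF linear_gl2_bracket_right linear_T])
  show "x \<in> span (basis_vec ` {b \<in> ext_gens k n. wght k n b < 0})"
    using assms by (simp add: neg_space_eq)
  fix x assume "x \<in> basis_vec ` {b \<in> ext_gens k n. wght k n b < 0}"
  then obtain b where b: "b \<in> ext_gens k n" "x = basis_vec b" "wght k n b < 0" by auto
  show "gl2_heis_bracket n (basis_vec (genEps m)) x = T x"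
    using b(1)
  proof (cases rule: ext_gens_cases)
    case (3 i)
    then obtain j where "i = m + j" using le_iff_add by (auto simp: m_def)
    moreover have "m + (m + j) + 5 = 2 * n \<longleftrightarrow> j = p"
      using n_eq by auto
    moreover have "T (basis_vec (genEps (m + j))) = (if j = p then \<sigma> *\<^sub>R \<eta> else 0)"
      using T_simps(3)[of j] unfolding e_def .
    ultimately show ?thesis
      using 3(1) b by (simp add: \<sigma>_def)
  qed (use b n_gt n_eq in \<open>auto simp: e_def\<close>)
qed

text \<open>The universal embedding of the extension fixes the negative part, so the image
  \<open>f ?e0\<close> acts there as e_0 does. It may be a different ambient vector, hence it is
  described by its action.\<close>

lemma e0_embedded:
  obtains A where "A \<in> G 0" "\<And>x. x \<in> neg_space G \<Longrightarrow> br A x = T x"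
proof -
  interpret ext: graded_lie_algebra "ext_grading k n" "gl2_heis_bracket n"
    by (rule ext_graded_lie_algebra)
  let ?e0 = "basis_vec (genEps m)"
  have "\<forall>G' br'. tanaka_extension (symbol_grading k n) (gl2_heis_bracket n) G' br' \<longrightarrow>
        (\<exists>f. linear_on (total_space G') f \<and> inj_on f (total_space G') \<and>
             (\<forall>i. f ` G' i \<subseteq> G i) \<and>
             (\<forall>x\<in>total_space G'. \<forall>y\<in>total_space G'. f (br' x y) = br (f x) (f y)) \<and>
             (\<forall>x\<in>neg_space (symbol_grading k n). f x = x))"
    using universal unfolding universal_tanaka_prolongation_def by (rule conjunct2)
  from this[rule_format, OF ext_tanaka]
  obtain f where f': "\<forall>i. f ` ext_grading k n i \<subseteq> G i"
    "\<forall>x\<in>total_space (ext_grading k n). \<forall>y\<in>total_space (ext_grading k n).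
       f (gl2_heis_bracket n x y) = br (f x) (f y)"
    "\<forall>x\<in>neg_space (symbol_grading k n). f x = x"
    by (elim exE conjE) (rule that)
  then have f: "\<And>i. f ` ext_grading k n i \<subseteq> G i"
    "\<And>x y. x \<in> total_space (ext_grading k n) \<Longrightarrow> y \<in> total_space (ext_grading k n) \<Longrightarrow>
       f (gl2_heis_bracket n x y) = br (f x) (f y)"
    "\<And>x. x \<in> neg_space (symbol_grading k n) \<Longrightarrow> f x = x"
    by auto
  have neg: "neg_space G = neg_space (symbol_grading k n)" "neg_space G = neg_space (ext_grading k n)"
    by (simp_all add: graded_sum_def neg_component ext_neg)
  have e0: "?e0 \<in> ext_grading k n 0"
    by (simp add: ext_zero span_base m_def)
  show ?thesis
  proof (rule that[of "f ?e0"])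
    show "f ?e0 \<in> G 0" using f(1) e0 by blast
    fix x assume x: "x \<in> neg_space G"
    have "f x = x" "gl2_heis_bracket n ?e0 x \<in> neg_space G"
      using f(3) x neg ext.br_deg0_neg[OF e0] by auto
    then show "br (f ?e0) x = T x"
      using f(2)[of ?e0 x] f(3) x neg bracket_e0[OF x] ext.component_total[OF e0] ext.neg_total[of x]
      by auto
  qed
qed

text \<open>The 2-cochain \<open>\<phi> = - X\<^sup>* \<and> e\<^sub>1\<^sup>* \<otimes> X + (e\<^sub>1\<^sup>* \<and> e\<^sub>p\<^sup>* \<otimes> e\<^sub>p + \<sigma> X\<^sup>* \<and> \<eta>\<^sup>* \<otimes> e\<^sub>p - e\<^sub>1\<^sup>* \<and> \<eta>\<^sup>* \<otimes> \<eta>) / 2\<close>. With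
  \<open>e\<^sub>0 \<cdot> X = - e\<^sub>1\<close>, \<open>e\<^sub>0 \<cdot> e\<^sub>p = \<sigma> \<eta>\<close>, \<open>e\<^sub>0 \<cdot> e\<^sub>1\<^sup>* = X\<^sup>*\<close>, \<open>e\<^sub>0 \<cdot> \<eta>\<^sup>* = - \<sigma> e\<^sub>p\<^sup>*\<close>, its image under \<open>e\<^sub>0\<close> is
  \<open>X\<^sup>* \<and> e\<^sub>1\<^sup>* \<otimes> e\<^sub>1 + \<sigma> e\<^sub>1\<^sup>* \<and> e\<^sub>p\<^sup>* \<otimes> \<eta> = \<partial>(e\<^sub>1\<^sup>* \<otimes> e\<^sub>0)\<close>.\<close>

definition obstruction2 :: "ambient \<Rightarrow> ambient \<Rightarrow> ambient" where
  "obstruction2 x y = (if x \<in> neg_space G \<and> y \<in> neg_space G then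
     (coordX y * coord 1 x - coordX x * coord 1 y) *\<^sub>R X
     + ((coord 1 x * coord p y - coord 1 y * coord p x
         + \<sigma> * (coordX x * coord\<eta> y - coordX y * coord\<eta> x)) / 2) *\<^sub>R e p
     + ((coord 1 y * coord\<eta> x - coord 1 x * coord\<eta> y) / 2) *\<^sub>R \<eta> else 0)"

text \<open>The cochain \<open>e\<^sub>1\<^sup>* \<otimes> e\<^sub>0\<close>, with \<open>A\<close>
  in the place of e_0.\<close>

definition obstruction1 :: "ambient \<Rightarrow> ambient \<Rightarrow> ambient" where
  "obstruction1 A x = (if x \<in> neg_space G then coord 1 x *\<^sub>R A else 0)"

section \<open>Weights of the two explicit cochains and the relation between them\<close>

lemma p_le: "p \<le> n - 2 + k"
  using n_gt k_le by auto

lemma e_p_neg: "e p \<in> neg_space G"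
  by (rule e_neg) (use p_le in auto)

lemma obstruction2_weight: "obstruction2 \<in> cochains2_weight G 1"
proof -
  have tot: "obstruction2 x y \<in> total_space G" for x y
    using e_p_neg by (auto simp: obstruction2_def intro!: neg_total)
  have "obstruction2 \<in> cochains2 G"
    unfolding cochains2_def
  proof (intro CollectI conjI ballI allI impI tot)
    fix x y assume "x \<in> neg_space G" "y \<in> neg_space G"
    then show "linear_on (neg_space G) (\<lambda>x. obstruction2 x y)" "linear_on (neg_space G) (obstruction2 x)"
      by (auto simp: linear_on_def obstruction2_def lookup_add algebra_simps add_divide_distrib diff_divide_distrib)
  qed (auto simp: obstruction2_def)
  moreover have "obstruction2 x y \<in> G (i + j + 1)" if "x \<in> G i" "y \<in> G j" "i < 0" "j < 0" for x y i j
  proof -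
    \<comment> \<open>A multiple of a homogeneous vector lies in \<open>G l\<close> once a nonzero
      coefficient forces the degree. Below, the nonzero coordinates in each coefficient determine
      \<open>i\<close> and \<open>j\<close>.\<close>
    have eq: "v \<in> G m \<Longrightarrow> (c \<noteq> 0 \<Longrightarrow> m = l) \<Longrightarrow> c *\<^sub>R v \<in> G l" for v c m l
      by (cases "c = 0") (auto intro: component_closed)
    note w = neg_component_coord[OF that(1,3)] neg_component_coord[OF that(2,4)]
    have wX: "coordX x \<noteq> 0 \<Longrightarrow> i = -1" "coordX y \<noteq> 0 \<Longrightarrow> j = -1"
      and w1: "coord 1 x \<noteq> 0 \<Longrightarrow> i = -1" "coord 1 y \<noteq> 0 \<Longrightarrow> j = -1"
      and wp: "coord p x \<noteq> 0 \<Longrightarrow> i = - int p" "coord p y \<noteq> 0 \<Longrightarrow> j = - int p"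
      and we: "coord\<eta> x \<noteq> 0 \<Longrightarrow> i = - int p" "coord\<eta> y \<noteq> 0 \<Longrightarrow> j = - int p"
      using w n_eq by (auto dest!: w simp: coord_def)
    have "- 1 = i + j + 1" if "coordX y * coord 1 x - coordX x * coord 1 y \<noteq> 0"
    proof -
      have "coordX y \<noteq> 0 \<and> coord 1 x \<noteq> 0 \<or> coordX x \<noteq> 0 \<and> coord 1 y \<noteq> 0"
        using that by auto
      then show ?thesis using wX w1 by auto
    qed
    then have "(coordX y * coord 1 x - coordX x * coord 1 y) *\<^sub>R X \<in> G (i + j + 1)"
      by (rule eq[OF X_G])
    moreover have "- int p = i + j + 1" if "(coord 1 x * coord p y - coord 1 y * coord p x
         + \<sigma> * (coordX x * coord\<eta> y - coordX y * coord\<eta> x)) / 2 \<noteq> 0"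
    proof -
      have "coord 1 x \<noteq> 0 \<and> coord p y \<noteq> 0 \<or> coord 1 y \<noteq> 0 \<and> coord p x \<noteq> 0 \<or>
        coordX x \<noteq> 0 \<and> coord\<eta> y \<noteq> 0 \<or> coordX y \<noteq> 0 \<and> coord\<eta> x \<noteq> 0"
        using that by auto
      then show ?thesis using wX w1 wp we by auto
    qed
    then have "((coord 1 x * coord p y - coord 1 y * coord p x
         + \<sigma> * (coordX x * coord\<eta> y - coordX y * coord\<eta> x)) / 2) *\<^sub>R e p \<in> G (i + j + 1)"
      using p_le by (intro eq[OF e_G]) auto
    moreover have "- int p = i + j + 1" if "(coord 1 y * coord\<eta> x - coord 1 x * coord\<eta> y) / 2 \<noteq> 0"
    proof -
      have "coord 1 y \<noteq> 0 \<and> coord\<eta> x \<noteq> 0 \<or> coord 1 x \<noteq> 0 \<and> coord\<eta> y \<noteq> 0"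
        using that by auto
      then show ?thesis using w1 we by auto
    qed
    then have "((coord 1 y * coord\<eta> x - coord 1 x * coord\<eta> y) / 2) *\<^sub>R \<eta> \<in> G (i + j + 1)"
      by (rule eq[OF eta_G])
    ultimately show ?thesis
      using component_neg[OF that(1,3)] component_neg[OF that(2,4)]
      by (simp add: obstruction2_def component_closed)
  qed
  ultimately show ?thesis by (simp add: cochains2_weight_def)
qed

lemma obstruction1_weight:
  assumes "A \<in> G 0"
  shows "obstruction1 A \<in> cochains1_weight G 1"
proof -
  have "coord 1 x *\<^sub>R A \<in> G (i + 1)" if "x \<in> G i" "i < 0" for x i
  proof (cases "coord 1 x = 0")
    case False
    then have "i + 1 = 0"
      using neg_component_coord[OF that, of "genEps (m + 1)"] n_eq by (simp add: coord_def)
    then show ?thesis using assms by (simp add: component_closed)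
  qed (simp add: component_closed)
  then show ?thesis
    using component_total[OF assms]
    by (auto simp: cochains1_weight_def cochains1_def linear_on_def obstruction1_def
        algebra_simps component_neg)
qed

text \<open>Brackets of negative elements have degree at most -2, whereas \<open>e 1\<close> has
  degree -1. Hence \<open>obstruction1 A\<close> vanishes on brackets, which removes the last term
  of its coboundary.\<close>

lemma coord_one_bracket:
  assumes "x \<in> neg_space G" "y \<in> neg_space G"
  shows "coord 1 (br x y) = 0"
proof -
  have s: "subspace {z. coord 1 z = 0}"
    by (auto simp: subspace_def)
  have "gl2_heis_bracket n x y \<in> {z. coord 1 z = 0}"
    using assms unfolding neg_space_eq
  proof (rule bilinear_on_span[OF _ _ linear_gl2_bracket_left linear_gl2_bracket_right _ s])
    fix u v assume "u \<in> basis_vec ` {b \<in> ext_gens k n. wght k n b < 0}"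
      "v \<in> basis_vec ` {b \<in> ext_gens k n. wght k n b < 0}"
    then obtain a b where ab: "u = basis_vec a" "v = basis_vec b" "a \<in> ext_gens k n" "b \<in> ext_gens k n"
      "wght k n a < 0" "wght k n b < 0" by auto
    have "coord 1 (gen_bracket n a b) = 0"
      using ab(3)
    proof (cases rule: ext_gens_cases)
      case a: 1
      show ?thesis using ab(4) by (cases rule: ext_gens_cases) (use a ab n_eq in \<open>auto simp: lookup_single coord_def\<close>)
    next
      case a: 2
      show ?thesis using ab(4) by (cases rule: ext_gens_cases) (use a ab n_eq in \<open>auto simp: lookup_single coord_def\<close>)
    next
      case a: 3
      show ?thesis using ab(4) by (cases rule: ext_gens_cases) (use a ab n_eq in \<open>auto simp: lookup_single coord_def\<close>)
    qed
    then show "gl2_heis_bracket n u v \<in> {z. coord 1 z = 0}" by (simp add: ab)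
  qed
  then show ?thesis using neg_bracket[OF assms] by simp
qed

lemma obstruction_eq:
  assumes A: "A \<in> G 0" and T: "\<And>x. x \<in> neg_space G \<Longrightarrow> br A x = T x"
  shows "cochain_action G br A obstruction2 = coboundary G br (obstruction1 A)"
proof (intro ext)
  fix x y
  show "cochain_action G br A obstruction2 x y = coboundary G br (obstruction1 A) x y"
  proof (cases "x \<in> neg_space G \<and> y \<in> neg_space G")
    case True
    then have x: "x \<in> neg_space G" and y: "y \<in> neg_space G" by auto
    have Tn: "T x \<in> neg_space G" "T y \<in> neg_space G"
      using br_deg0_neg[OF A x] br_deg0_neg[OF A y] T x y by auto
    have o: "obstruction2 x y \<in> neg_space G"
      using e_p_neg by (auto simp: obstruction2_def)
    have xA: "br x A = - T x" "br y A = - T y"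
      using br_antisym[of x A] br_antisym[of y A] x y T component_total[OF A] neg_total by auto
    have c: "coordX (T z) = 0" "coord 1 (T z) = - coordX z" "coord p (T z) = 0" "coord\<eta> (T z) = \<sigma> * coord p z" for z
      by (simp_all add: T_def lookup_add lookup_minus)
    have "coboundary G br (obstruction1 A) x y = coord 1 x *\<^sub>R T y - coord 1 y *\<^sub>R T x"
      using x y br_neg[OF x y] component_total[OF A]
      by (simp add: coboundary_def obstruction1_def coord_one_bracket[unfolded One_nat_def] br_linear neg_total xA)
    moreover have "cochain_action G br A obstruction2 x y
      = T (obstruction2 x y) - obstruction2 (T x) y - obstruction2 x (T y)"
      using x y by (simp add: cochain_action_def T o Tn neg_part_neg)
    \<comment> \<open>Both sides are combinations of \<open>X\<close>, \<open>e 1\<close>,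
      \<open>e p\<close> and \<open>\<eta>\<close>. At an arbitrary coordinate \<open>b\<close> the
      claim becomes a polynomial identity modulo \<sigma>^2 = 1.\<close>
    moreover have "\<dots> = coord 1 x *\<^sub>R T y - coord 1 y *\<^sub>R T x"
    proof (rule poly_mapping_eqI)
      fix b :: gen
      let ?l = "\<lambda>v. Poly_Mapping.lookup v b"
      have ss: "\<sigma> * \<sigma> = 1"
        using sigma_sigma[of 1] by simp
      have 1: "?l (T z) = - coordX z * ?l (e 1) + \<sigma> * coord p z * ?l \<eta>" for z
        by (simp add: T_def lookup_add lookup_minus)
      have 2: "?l (obstruction2 u v) = (coordX v * coord 1 u - coordX u * coord 1 v) * ?l X
         + (coord 1 u * coord p v - coord 1 v * coord p u
             + \<sigma> * (coordX u * coord\<eta> v - coordX v * coord\<eta> u)) / 2 * ?l (e p)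
         + (coord 1 v * coord\<eta> u - coord 1 u * coord\<eta> v) / 2 * ?l \<eta>"
        if "u \<in> neg_space G" "v \<in> neg_space G" for u v
        using that by (simp add: obstruction2_def lookup_add)
      have 3: "coordX (obstruction2 x y) = coordX y * coord 1 x - coordX x * coord 1 y"
        "coord p (obstruction2 x y) = (coord 1 x * coord p y - coord 1 y * coord p x
             + \<sigma> * (coordX x * coord\<eta> y - coordX y * coord\<eta> x)) / 2"
        using x y by (simp_all add: obstruction2_def lookup_add)
      show "?l (T (obstruction2 x y) - obstruction2 (T x) y - obstruction2 x (T y))
        = ?l (coord 1 x *\<^sub>R T y - coord 1 y *\<^sub>R T x)"
        unfolding lookup_minus lookup_scaleR 1 2[OF Tn(1) y] 2[OF x Tn(2)] 3 c real_scaleR_def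
        using ss by (simp only: field_simps) algebra
    qed
    ultimately show ?thesis by simp
  qed (auto simp: cochain_action_def coboundary_def)
qed

section \<open>Derivations and the contradictory linear equations\<close>

declare One_nat_def [simp del]

lemma e_neg_small [simp]: "e 1 \<in> neg_space G" "e 2 \<in> neg_space G"
    "e 3 \<in> neg_space G" "e 4 \<in> neg_space G"
  using n_gt by (auto intro!: e_neg)

lemmas basis_total [simp] = X_neg[THEN neg_total] eta_neg[THEN neg_total] e_neg_small[THEN neg_total]

lemma e_neq: "e i \<noteq> 0" "\<eta> \<noteq> 0"
  by (simp_all add: e_def)

lemma br_X_e_small: "br X (e 1) = e 2" "br X (e 2) = e 3" "br X (e 3) = e 4"
  using br_X_e[of 1] br_X_e[of 2] br_X_e[of 3] n_gt by simp_all

text \<open>The sum 1 + 3 is even, while p is odd.\<close>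

lemma br_e1_e3: "br (e 1) (e 3) = 0"
  using n_gt by (auto simp: br_e_e)

text \<open>The factor \<open>\<kappa>\<close> covers p = 3 and p > 3 at once, so that the formulas
  below are uniform in \<open>k\<close>.\<close>

lemma br_e1_e2:
  obtains \<kappa> where "br (e 1) (e 2) = \<kappa> *\<^sub>R \<eta>" "\<kappa> = 0 \<longleftrightarrow> k \<noteq> 0"
proof (rule that)
  have "br (e 1) (e 2) = (if 1 + 2 = p then (\<sigma> * (- 1) ^ 1) *\<^sub>R \<eta> else 0)"
    by (rule br_e_e) (use n_gt in auto)
  then show "br (e 1) (e 2) = (if 1 + 2 = p then \<sigma> * (- 1) ^ 1 else 0) *\<^sub>R \<eta>"
    by (cases "1 + 2 = p") (simp_all only: if_True if_False scaleR_zero_left simp_thms)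
  have "(if 1 + 2 = p then r else 0) = 0 \<longleftrightarrow> k \<noteq> 0" if "r \<noteq> 0" for r :: real
    using that by auto
  then show "(if 1 + 2 = p then \<sigma> * (- 1) ^ 1 else 0) = 0 \<longleftrightarrow> k \<noteq> 0"
    by (simp only: \<sigma>_def) simp
qed

lemma scaleR_numeral:
  "(r * 2) *\<^sub>R x = r *\<^sub>R x + r *\<^sub>R x"
  "(r * 3) *\<^sub>R x = r *\<^sub>R x + r *\<^sub>R x + r *\<^sub>R x"
  "(r * 4) *\<^sub>R x = r *\<^sub>R x + r *\<^sub>R x + r *\<^sub>R x + r *\<^sub>R x"
  for x :: "'b::real_vector"
  by (simp_all flip: scaleR_add_left)

text \<open>\<open>br z\<close> is a derivation, hence determined by its values on \<open>X\<close>
  and \<open>e 1\<close>. That c = 0 follows by applying it to a vanishing bracket: [e_1, e_3] = 0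
  gives c e_4 = 0 if k = 0, and [e_1, e_2] = 0 gives c e_3 = 0 otherwise.\<close>

lemma deg0_action:
  assumes z: "z \<in> G 0" and X: "br z X = a *\<^sub>R X + b *\<^sub>R e 1" and e1: "br z (e 1) = c *\<^sub>R X + d *\<^sub>R e 1"
  shows "br z (e 2) = (a + d) *\<^sub>R e 2"
    "br z (e 3) = (2 * a + d) *\<^sub>R e 3 + b *\<^sub>R br (e 1) (e 2)"
    "c = 0"
    "br z (e 4) = (3 * a + d) *\<^sub>R e 4"
    "br z (br (e 1) (e 2)) = (a + 2 * d) *\<^sub>R br (e 1) (e 2)"
proof -
  note zt = component_total[OF z]
  note der = jacobi_derivation[OF zt]
  have e1X: "br (e 1) X = - e 2" "br (e 2) (e 2) = 0" "br (e 1) (e 1) = 0" "br X X = 0"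
    using br_antisym[of "e 1" X] by (simp_all add: br_X_e_small bracket_self)
  show 2: "br z (e 2) = (a + d) *\<^sub>R e 2"
    using der[of X "e 1"] X e1 e1X by (simp add: br_X_e_small br_linear algebra_simps scaleR_numeral)
  show 3: "br z (e 3) = (2 * a + d) *\<^sub>R e 3 + b *\<^sub>R br (e 1) (e 2)"
    using der[of X "e 2"] X 2 by (simp add: br_X_e_small br_linear algebra_simps scaleR_numeral)
  obtain \<kappa> where \<kappa>: "br (e 1) (e 2) = \<kappa> *\<^sub>R \<eta>" "\<kappa> = 0 \<longleftrightarrow> k \<noteq> 0"
    by (rule br_e1_e2)
  have X12: "br X (br (e 1) (e 2)) = 0" "br (e 1) (br (e 1) (e 2)) = 0"
    using br_e_eta[of 1] n_gt by (simp_all add: \<kappa>(1) br_linear br_X_eta)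
  show c: "c = 0"
  proof (cases "k = 0")
    case True
    have "br z (br (e 1) (e 3)) = c *\<^sub>R e 4"
      using der[of "e 1" "e 3"] e1 3 br_e1_e3 X12
      by (simp add: br_X_e_small br_linear)
    then show ?thesis
      using zt by (simp add: br_e1_e3 e_neq)
  next
    case False
    then have 12: "br (e 1) (e 2) = 0"
      using \<kappa> by simp
    then have "br z (br (e 1) (e 2)) = c *\<^sub>R e 3"
      using der[of "e 1" "e 2"] e1 2
      by (simp add: br_X_e_small br_linear)
    then show ?thesis
      using zt 12 by (simp add: e_neq)
  qed
  show "br z (e 4) = (3 * a + d) *\<^sub>R e 4"
    using der[of X "e 3"] X 3 X12 br_e1_e3
    by (simp add: br_X_e_small br_linear algebra_simps scaleR_numeral)
  show "br z (br (e 1) (e 2)) = (a + 2 * d) *\<^sub>R br (e 1) (e 2)"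
    using der[of "e 1" "e 2"] e1 2 c by (simp add: br_linear algebra_simps scaleR_numeral)
qed

lemma deg0_eigen:
  assumes z: "z \<in> G 0"
  obtains a b d where "br z X = a *\<^sub>R X + b *\<^sub>R e 1" "br z (e 1) = d *\<^sub>R e 1"
proof -
  have "br z X \<in> G (- 1)" "br z (e 1) \<in> G (- 1)"
    using bracket_degree[OF z X_G] bracket_degree[OF z e_G[of 1]] n_gt by auto
  note eq = G_minus_one[OF this(1)] G_minus_one[OF this(2)]
  show ?thesis
  proof (rule that[OF eq(1)])
    show "br z (e 1) = coord 1 (br z (e 1)) *\<^sub>R e 1"
      using eq(2) deg0_action(3)[OF z eq] by simp
  qed
qed

lemma no_normalization: "\<not> linear_invariant_normalization G br N"
proof
  assume N: "linear_invariant_normalization G br N"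
  obtain A where A: "A \<in> G 0" and T: "\<And>x. x \<in> neg_space G \<Longrightarrow> br A x = T x"
    using e0_embedded by blast
  obtain \<psi> where \<psi>: "\<psi> \<in> cochains1_weight G 1"
    and cocycle: "\<And>i j x y. i < 0 \<Longrightarrow> j < 0 \<Longrightarrow> x \<in> G i \<Longrightarrow> y \<in> G j \<Longrightarrow>
       coboundary G br (\<lambda>x. act1 A \<psi> x - obstruction1 A x) x y = 0"
    using normalization_obstruction[OF N A _ obstruction2_weight obstruction1_weight[OF A]
        obstruction_eq[OF A T]] by auto
  have \<psi>1: "\<psi> \<in> cochains1 G" and \<psi>G: "\<And>i x. i < 0 \<Longrightarrow> x \<in> G i \<Longrightarrow> \<psi> x \<in> G (i + 1)"
    using \<psi> by (auto simp: cochains1_weight_def)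
  \<comment> \<open>\<open>D = e\<^sub>0 \<cdot> \<psi> - \<psi>\<^sub>0\<close> is a derivation by \<open>cocycle\<close>.\<close>
  define D where "D x = act1 A \<psi> x - obstruction1 A x" for x
  have der: "D (br x y) = br x (D y) - br y (D x)" if "i < 0" "j < 0" "x \<in> G i" "y \<in> G j" for i j x y
    using cocycle[OF that] that component_neg by (simp add: coboundary_def D_def)
  have D: "D x = br A (\<psi> x) - \<psi> (T x) - coord 1 x *\<^sub>R A" if "x \<in> neg_space G" for x
    using that T by (simp add: D_def act1_def obstruction1_def)
  have \<psi>0: "\<psi> 0 = 0"
    using cochains1D(2)[OF \<psi>1, of 0 0] by simp
  have X1: "X \<in> G (- 1)" and e1: "e 1 \<in> G (- 1)" and e2: "e 2 \<in> G (- 2)" and e3: "e 3 \<in> G (- 3)"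
    and e4: "e 4 \<in> G (- 4)"
    using X_G e_G[of 1] e_G[of 2] e_G[of 3] e_G[of 4] n_gt by auto
  define u v where "u = \<psi> (e 1)" and "v = \<psi> X"
  have u: "u \<in> G 0" and v: "v \<in> G 0"
    using \<psi>G[OF _ e1] \<psi>G[OF _ X1] by (auto simp: u_def v_def)
  note At = component_total[OF A] and ut = component_total[OF u] and vt = component_total[OF v]
  \<comment> \<open>This is D X: as T X = -e_1, the term -\<psi>(T X) contributes
    \<open>u\<close>.\<close>
  define U where "U = br A v + u"
  have U: "U \<in> G 0"
    using bracket_degree[OF A v] u by (auto simp: U_def intro: component_closed)
  note Ut = component_total[OF U]
  obtain a b d where ab: "br u X = a *\<^sub>R X + b *\<^sub>R e 1" "br u (e 1) = d *\<^sub>R e 1"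
    using deg0_eigen[OF u] by blast
  obtain a' b' d' where ab': "br v X = a' *\<^sub>R X + b' *\<^sub>R e 1" "br v (e 1) = d' *\<^sub>R e 1"
    using deg0_eigen[OF v] by blast
  have Te1: "T (e 1) = 0" "T (e 2) = 0" "T (e 4) = 0"
    by auto
  have AX: "br A X = - e 1" "br A (e 1) = 0"
    using T[of X] T[of "e 1"] Te1 by simp_all
  \<comment> \<open>The commutator of \<open>A\<close> and \<open>v\<close> changes only the
    coefficient of \<open>e 1\<close> in the action on \<open>X\<close>, so the numbers
    \<open>a\<close> and \<open>d\<close> are those of \<open>u\<close>.\<close>
  have UX: "br U X = a *\<^sub>R X + (b - a' + d') *\<^sub>R e 1"
    using ab ab' AX jacobi_derivation_left[OF At vt, of X] At ut vt
    by (simp add: U_def br_linear algebra_simps scaleR_numeral)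
  have Ue1: "br U (e 1) = 0 *\<^sub>R X + d *\<^sub>R e 1"
    using ab ab' AX jacobi_derivation_left[OF At vt, of "e 1"] At ut vt
    by (simp add: U_def br_linear algebra_simps scaleR_numeral)
  note Uact = deg0_action[OF U UX Ue1]
  have DX: "D X = U"
    using D[of X] cochains1_minus[OF \<psi>1, of "e 1"] by (simp add: U_def u_def v_def)
  have De1: "D (e 1) = br A u - A"
    using D[of "e 1"] Te1 by (simp add: u_def \<psi>0)
  \<comment> \<open>The constant -1 comes from the term -A in D e_1, contributed by
    \<open>obstruction1 A\<close>; it makes the equations below inhomogeneous.\<close>
  have XDe1: "br X (D (e 1)) = (a - d - 1) *\<^sub>R e 1"
    using br_antisym[of X "D (e 1)"] jacobi_derivation_left[OF At ut, of X] ab AX At ut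
    by (simp add: De1 br_linear algebra_simps scaleR_numeral)
  have swap: "br x U = - br U x" if "x \<in> neg_space G" for x
    using br_antisym[OF neg_total[OF that] Ut] .
  \<comment> \<open>From here on e_(i+1) = [X, e_i] determines D e_(i+1) from D e_i and the action
    of \<open>U\<close>.\<close>
  have De2: "D (e 2) = (a - 1) *\<^sub>R e 1"
    using der[OF _ _ X1 e1] XDe1 Ue1 swap[of "e 1"] by (simp add: DX br_X_e_small algebra_simps scaleR_numeral)
  have De3: "D (e 3) = (2 * a + d - 1) *\<^sub>R e 2"
    using der[OF _ _ X1 e2] De2 Uact(1) swap[of "e 2"]
    by (simp add: DX br_X_e_small br_linear algebra_simps scaleR_numeral)
  have De4: "D (e 4) = (4 * a + 2 * d - 1) *\<^sub>R e 3 + (b - a' + d') *\<^sub>R br (e 1) (e 2)"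
    using der[OF _ _ X1 e3] De3 Uact(2) swap[of "e 3"]
    by (simp add: DX br_X_e_small br_linear algebra_simps scaleR_numeral)
  have T_G: "T x = 0" if "x \<in> G i" "i < 0" "i \<noteq> - 1" "i \<noteq> - int p" for x i
  proof -
    have "coordX x = 0"
      using neg_component_coord[OF that(1,2), of genX] that(3) by auto
    moreover have "coord p x = 0"
      using neg_component_coord[OF that(1,2), of "genEps (m + p)"] that(4) n_eq by (auto simp: coord_def)
    ultimately show ?thesis by (simp add: T_def)
  qed
  \<comment> \<open>For these i both T e_i and the value of \<open>obstruction1 A\<close> at e_i
    vanish, and \<psi>(e_i) still has negative degree. So D e_i lies in the image of
    \<open>T\<close>, and its coordinates at e_2, e_3, ... must be 0.\<close>
  have D_T: "D (e i) = T (\<psi> (e i))" if "2 \<le> i" "i \<noteq> p" "i \<le> n - 2 + k" for i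
  proof -
    have "\<psi> (e i) \<in> G (1 - int i)"
      using \<psi>G[OF _ e_G[of i]] that by simp
    then have "\<psi> (e i) \<in> neg_space G"
      using that component_neg by auto
    then show ?thesis
      using D[OF e_neg[of i]] T that by (simp add: \<psi>0)
  qed
  have coord_T: "coord i (T x) = 0" if "2 \<le> i" for i x
    using that by (simp add: T_def)
  obtain \<kappa> where \<kappa>: "br (e 1) (e 2) = \<kappa> *\<^sub>R \<eta>" "\<kappa> = 0 \<longleftrightarrow> k \<noteq> 0"
    by (rule br_e1_e2)
  have eq4: "4 * a + 2 * d = 1"
  proof -
    have "coord 3 (D (e 4)) = 0"
      using D_T[of 4] coord_T[of 3] n_gt by (auto; presburger)
    then show ?thesis by (simp add: De4 \<kappa>(1))
  qed
  show False
  proof (cases "k = 0")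
    case False
    \<comment> \<open>Here p > 3, so e_3 gives 2a + d = 1, against \<open>eq4\<close>.\<close>
    then have "coord 2 (D (e 3)) = 0"
      using D_T[of 3] coord_T[of 2] n_gt by simp
    then show False using eq4 by (simp add: De3)
  next
    case True
    \<comment> \<open>Now p = 3, so \<open>D_T\<close> excludes e_3 and \<open>\<eta>\<close> takes
      its place: \<psi>(\<eta>) has degree -2, where \<open>T\<close> vanishes, so D \<eta> = 0 and
      \<open>U\<close> annihilates \<open>\<eta>\<close>, hence also [e_1, e_2], a nonzero multiple
      of it.\<close>
    have \<psi>\<eta>: "\<psi> \<eta> \<in> G (1 - int p)"
      using \<psi>G[OF _ eta_G] by simp
    then have "\<psi> \<eta> \<in> neg_space G" "T (\<psi> \<eta>) = 0"
      using T_G[OF \<psi>\<eta>] component_neg[OF \<psi>\<eta>] by auto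
    then have "D \<eta> = 0"
      using D[of \<eta>] T[of "\<psi> \<eta>"] by (simp add: \<psi>0)
    moreover have "D 0 = 0"
      using D[of 0] At by (simp add: \<psi>0)
    ultimately have "br U \<eta> = 0"
      using der[OF _ _ X1 eta_G] swap[of \<eta>] by (simp add: br_X_eta DX)
    then have "br U (br (e 1) (e 2)) = 0"
      using Ut by (simp add: \<kappa>(1) br_linear)
    then have "(a + 2 * d) * \<kappa> = 0"
      using Uact(5) by (simp add: \<kappa>(1) e_neq)
    then have "a + 2 * d = 0"
      using \<kappa>(2) True by simp
    \<comment> \<open>The last equation comes from [X, e_4], which is e_5 for n > 6 and 0 for n = 6,
      where e_4 is the top element. In both cases \<open>D\<close> of it has no
      e_4-coordinate.\<close>
    moreover have "3 * a + d = 0"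
    proof -
      have "coord 4 (D (br X (e 4))) = 0"
      proof (cases "n = 6")
        case n: True
        have "4 = n - 2 + k" using n True by simp
        from br_X_e_top[OF this] show ?thesis using \<open>D 0 = 0\<close> by simp
      next
        case n: False
        have "4 < n - 2 + k" "5 \<noteq> p" using n True n_gt by auto
        then show ?thesis
          using br_X_e[of 4] D_T[of 5] coord_T[of 4] by simp
      qed
      moreover have "br X (D (e 4)) = 0"
        by (simp add: De4 eq4 \<kappa>(1) br_linear br_X_eta)
      ultimately show ?thesis
        using der[OF _ _ X1 e4] swap[of "e 4"] Uact(4) by (simp add: DX)
    qed
    \<comment> \<open>The two homogeneous equations force a = d = 0, against 4a + 2d = 1.\<close>
    ultimately show False using eq4 by simp
  qed
qed

end

theorem theorem5p6:
  fixes n k :: nat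
  assumes "n > 5" and "k \<le> n - 5"
  shows "\<not> admits_linear_invariant_normalization (symbol_grading k n) (gl2_heis_bracket n)"
proof
  assume "admits_linear_invariant_normalization (symbol_grading k n) (gl2_heis_bracket n)"
  then obtain G br N where univ: "universal_tanaka_prolongation (symbol_grading k n) (gl2_heis_bracket n) G br"
    and N: "linear_invariant_normalization G br N"
    unfolding admits_linear_invariant_normalization_def by (elim exE conjE)
  interpret graded_lie_algebra G br
    using univ by (simp add: universal_tanaka_prolongation_def tanaka_extension_def)
  interpret symbol_prolongation n k G br
    by unfold_locales (use assms univ in auto)
  show False using no_normalization N by blast
qed

end
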